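(* Let $\Omega\subset\mathbb C$ be a simply connected domain. The isometry group $\operatorname{Iso}(H^\infty(\Omega))$ and the automorphism group $\operatorname{Aut}(H^\infty(\Omega))$ are topologically reflexive.
   Context: A domain is a (nonempty) open connected subset of $\mathbb C$. $H^\infty(\Omega)$ is the Banach algebra of all bounded holomorphic functions $\Omega\to\mathbb C$ with the sup-norm. For a Banach algebra $\mathscr A$: $\operatorname{Iso}(\mathscr A)$ is the group of all surjective linear isometries; $\operatorname{Aut}(\mathscr A)$ is the group of all continuous (linear) algebra automorphisms; $B(\mathscr A)$ is the algebra of all continuous linear operators on $\mathscr A$. For $\mathscr S\subset B(\mathscr A)$ put $\operatorname{ref}_{to}\mathscr S=\{T\in B(\mathscr A): Tx\in\overline{\{Lx:L\in\mathscr S\}}\text{ for all }x\in\mathscr A\}$ (closure in $\mathscr A$); $\mathscr S$ is topologically reflexive if $\operatorname{ref}_{to}\mathscr S=\mathscr S$. *)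

theory Defs
  imports "HOL-Complex_Analysis.Complex_Analysis" "HOL-Library.FuncSet"
begin

text \<open>Functions on \<open>\<Omega>\<close> are represented by their extension by zero, so that
  equality of elements of the carrier is equality on \<open>\<Omega>\<close> and the carrier is
  closed under the pointwise operations.\<close>

definition H_infinity :: "complex set \<Rightarrow> (complex \<Rightarrow> complex) set" where
  "H_infinity \<Omega> =
     {f. f holomorphic_on \<Omega> \<and> bounded (f ` \<Omega>) \<and> (\<forall>z. z \<notin> \<Omega> \<longrightarrow> f z = 0)}"

definition sup_norm :: "complex set \<Rightarrow> (complex \<Rightarrow> complex) \<Rightarrow> real" where
  "sup_norm \<Omega> f = (SUP z\<in>\<Omega>. norm (f z))"

text \<open>In the following, \<open>A\<close> is the carrier of a Banach algebra of complex-valued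
  functions with pointwise operations, and \<open>N\<close> is its norm. Operators on \<open>A\<close> are
  extensional (equal to \<^const>\<open>undefined\<close> off \<open>A\<close>), so that they are determined by
  their values on \<open>A\<close> and sets of operators can be compared by equality.\<close>

text \<open>The locale \<^locale>\<open>Metric_space\<close> requires a symmetric nonnegative distance also
  off the carrier, hence the value \<open>0\<close> there.\<close>

definition norm_dist ::
  "('x \<Rightarrow> complex) set \<Rightarrow> (('x \<Rightarrow> complex) \<Rightarrow> real) \<Rightarrow>
     ('x \<Rightarrow> complex) \<Rightarrow> ('x \<Rightarrow> complex) \<Rightarrow> real" where
  "norm_dist A N f g = (if f \<in> A \<and> g \<in> A then N (\<lambda>x. f x - g x) else 0)"

definition norm_topology ::
  "('x \<Rightarrow> complex) set \<Rightarrow> (('x \<Rightarrow> complex) \<Rightarrow> real) \<Rightarrow> ('x \<Rightarrow> complex) topology" where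
  "norm_topology A N = Metric_space.mtopology A (norm_dist A N)"

definition linear_operators ::
  "('x \<Rightarrow> complex) set \<Rightarrow> (('x \<Rightarrow> complex) \<Rightarrow> ('x \<Rightarrow> complex)) set" where
  "linear_operators A =
     {T \<in> A \<rightarrow>\<^sub>E A.
        (\<forall>f\<in>A. \<forall>g\<in>A. T (\<lambda>x. f x + g x) = (\<lambda>x. T f x + T g x)) \<and>
        (\<forall>c. \<forall>f\<in>A. T (\<lambda>x. c * f x) = (\<lambda>x. c * T f x))}"

definition bounded_operators ::
  "('x \<Rightarrow> complex) set \<Rightarrow> (('x \<Rightarrow> complex) \<Rightarrow> real) \<Rightarrow>
     (('x \<Rightarrow> complex) \<Rightarrow> ('x \<Rightarrow> complex)) set" where
  "bounded_operators A N =
     {T \<in> linear_operators A. continuous_map (norm_topology A N) (norm_topology A N) T}"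

definition Iso ::
  "('x \<Rightarrow> complex) set \<Rightarrow> (('x \<Rightarrow> complex) \<Rightarrow> real) \<Rightarrow>
     (('x \<Rightarrow> complex) \<Rightarrow> ('x \<Rightarrow> complex)) set" where
  "Iso A N = {T \<in> linear_operators A. T ` A = A \<and> (\<forall>f\<in>A. N (T f) = N f)}"

definition Aut ::
  "('x \<Rightarrow> complex) set \<Rightarrow> (('x \<Rightarrow> complex) \<Rightarrow> real) \<Rightarrow>
     (('x \<Rightarrow> complex) \<Rightarrow> ('x \<Rightarrow> complex)) set" where
  "Aut A N =
     {T \<in> bounded_operators A N. bij_betw T A A \<and>
        (\<forall>f\<in>A. \<forall>g\<in>A. T (\<lambda>x. f x * g x) = (\<lambda>x. T f x * T g x))}"

definition ref_to ::
  "('x \<Rightarrow> complex) set \<Rightarrow> (('x \<Rightarrow> complex) \<Rightarrow> real) \<Rightarrow>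
     (('x \<Rightarrow> complex) \<Rightarrow> ('x \<Rightarrow> complex)) set \<Rightarrow> (('x \<Rightarrow> complex) \<Rightarrow> ('x \<Rightarrow> complex)) set" where
  "ref_to A N S =
     {T \<in> bounded_operators A N. \<forall>f\<in>A. T f \<in> norm_topology A N closure_of {L f |L. L \<in> S}}"

definition topologically_reflexive ::
  "('x \<Rightarrow> complex) set \<Rightarrow> (('x \<Rightarrow> complex) \<Rightarrow> real) \<Rightarrow>
     (('x \<Rightarrow> complex) \<Rightarrow> ('x \<Rightarrow> complex)) set \<Rightarrow> bool" where
  "topologically_reflexive A N S \<longleftrightarrow> ref_to A N S = S"

lemma sup_norm_upper:
  assumes "f \<in> H_infinity \<Omega>" "z \<in> \<Omega>"
  shows "norm (f z) \<le> sup_norm \<Omega> f"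
proof -
  have "bdd_above ((\<lambda>z. norm (f z)) ` \<Omega>)"
    using assms(1) by (auto simp: H_infinity_def bounded_iff bdd_above_def)
  then show ?thesis
    unfolding sup_norm_def using assms(2) by (rule cSUP_upper2) auto
qed

lemma H_infinity_diff:
  assumes "f \<in> H_infinity \<Omega>" "g \<in> H_infinity \<Omega>"
  shows "(\<lambda>z. f z - g z) \<in> H_infinity \<Omega>"
  using assms by (auto simp: H_infinity_def intro!: holomorphic_intros bounded_minus_comp)

lemma Metric_space_H_infinity:
  assumes "\<Omega> \<noteq> {}"
  shows "Metric_space (H_infinity \<Omega>) (norm_dist (H_infinity \<Omega>) (sup_norm \<Omega>))"
    (is "Metric_space ?A ?d")
proof
  obtain w where w: "w \<in> \<Omega>" using assms by blast
  have up: "norm (f z - g z) \<le> ?d f g" if "f \<in> ?A" "g \<in> ?A" "z \<in> \<Omega>" for f g z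
    using sup_norm_upper[OF H_infinity_diff[OF that(1,2)] that(3)] that
    by (simp add: norm_dist_def)
  show "0 \<le> ?d f g" for f g
    using up[of f g w] w order_trans[OF norm_ge_zero]
    by (cases "f \<in> ?A \<and> g \<in> ?A") (auto simp: norm_dist_def)
  show "?d f g = ?d g f" for f g
    by (simp add: norm_dist_def sup_norm_def norm_minus_commute)
  show "(?d f g = 0) = (f = g)" if "f \<in> ?A" "g \<in> ?A" for f g
  proof
    assume "?d f g = 0"
    then have "f z = g z" if "z \<in> \<Omega>" for z
      using up[OF \<open>f \<in> ?A\<close> \<open>g \<in> ?A\<close> that] by simp
    moreover have "f z = g z" if "z \<notin> \<Omega>" for z
      using that \<open>f \<in> ?A\<close> \<open>g \<in> ?A\<close> by (simp add: H_infinity_def)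
    ultimately show "f = g" by blast
  qed (use assms that in \<open>simp add: norm_dist_def sup_norm_def\<close>)
  show "?d f h \<le> ?d f g + ?d g h" if "f \<in> ?A" "g \<in> ?A" "h \<in> ?A" for f g h
  proof -
    have "norm (f z - h z) \<le> ?d f g + ?d g h" if "z \<in> \<Omega>" for z
      using up[OF \<open>f \<in> ?A\<close> \<open>g \<in> ?A\<close> that] up[OF \<open>g \<in> ?A\<close> \<open>h \<in> ?A\<close> that]
        norm_diff_triangle_ineq[of "f z" "g z" "g z" "h z"]
      by (smt (verit) dist_norm dist_triangle)
    then have "sup_norm \<Omega> (\<lambda>z. f z - h z) \<le> ?d f g + ?d g h"
      unfolding sup_norm_def using assms by (intro cSUP_least) auto
    then show ?thesis
      using that by (simp add: norm_dist_def)
  qed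
qed

end

theory Submission
  imports Defs "HOL-Computational_Algebra.Fundamental_Theorem_Algebra"
begin

text \<open>
  Write \<open>A\<close> for the algebra of bounded holomorphic functions on \<open>\<Omega>\<close>. Three facts combine.

  \<^emph>\<open>Surjective isometries are multiplicative up to a unimodular constant.\<close> This holds on
  every planar domain. The unit ball of \<open>A\<close> is invariant under the pointwise Moebius maps
  \<open>f \<mapsto> (f + t) / (1 + cnj t * f)\<close>. To first order in \<open>t\<close> they move \<open>f\<close> along the vector field
  \<open>f \<mapsto> t - cnj t * f\<^sup>2\<close>. A surjective linear isometry \<open>L\<close> carries it to another vector field
  tangent to the unit sphere, \<open>g \<mapsto> t * L 1 - cnj t * L ((L\<^sup>-\<^sup>1 g)\<^sup>2)\<close>. Tangency at the
  constant function \<open>1\<close> says that the complex conjugate of \<open>L 1\<close> is again holomorphic, so \<open>L 1\<close>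
  is a constant (\<open>Iso_one\<close>). If \<open>L 1 = 1\<close>, then the two fields differ
  by a multiple of the homogeneous quadratic field \<open>g \<mapsto> L ((L\<^sup>-\<^sup>1 g)\<^sup>2) - g\<^sup>2\<close>. The flow
  of this field preserves the ball for all times and agrees with the identity to first order
  at \<open>0\<close>, which by Cartan's uniqueness argument is possible only for the zero field
  (\<open>quadratic_field_vanishes\<close>). Hence \<open>L\<close> preserves squares and therefore products
  (\<open>Iso_multiplicative\<close>).

  \<^emph>\<open>Multiplicativity survives the closure.\<close> Let \<open>T\<close> lie in the reflexive closure of the isometry
  group. It agrees approximately with an isometry at each single function, but with different
  isometries at different functions, so the product rule does not pass to the limit directly.
  Being bounded away from zero involves only one function and does pass to the limit. Since
  \<open>T 1\<close> is a unimodular constant, the Gleason-Kahane-Zelazko theorem (\<open>GKZ_square\<close>) shows that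
  \<open>T\<close> divided by this constant is a homomorphism.

  \<^emph>\<open>Homomorphisms are determined by the image of the Riemann map.\<close> Let \<open>r\<close> be a Riemann map of
  \<open>\<Omega>\<close> with inverse \<open>s\<close>. As \<open>f - f a\<close> is divisible by \<open>r - r a\<close> in \<open>A\<close>, a unital
  homomorphism \<open>V\<close> with \<open>V r\<close> mapping \<open>\<Omega>\<close> into the disc is composition with
  \<open>s \<circ> V r\<close> (\<open>hom_is_composition\<close>). For the operator \<open>T\<close> above, \<open>T r\<close> is a uniform limit of
  biholomorphic maps onto the disc and therefore biholomorphic (\<open>limit_of_bijections\<close>), so \<open>T\<close>
  is surjective. For \<open>\<Omega> = \<complex>\<close> the algebra consists of constants and surjectivity is immediate.

  For the automorphism group it remains to observe that automorphisms preserve spectral radii,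
  which are sup norms here; they are thus exactly the surjective isometries fixing \<open>1\<close>
  (\<open>Aut_eq\<close>), and this condition is closed.
\<close>

section \<open>Vector fields tangent to the unit disc\<close>

lemma norm_add_square:
  "(norm (a + b))\<^sup>2 = (norm a)\<^sup>2 + 2 * Re (cnj a * b) + (norm b)\<^sup>2" for a b :: complex
  by (simp add: cmod_power2) (simp add: power2_eq_square algebra_simps)

text \<open>
  The field \<open>t - cnj t * z\<^sup>2\<close> is the first-order part in \<open>t\<close> of a Moebius transformation of the disc, so a step along it
  leaves the disc only to second order in \<open>t\<close>.
\<close>
lemma disc_field_bound:
  fixes z t :: complex
  assumes z: "norm z \<le> 1" and t: "norm t \<le> 1/2"
  shows "norm (z + (t - cnj t * z\<^sup>2)) \<le> 1 + 2 * (norm t)\<^sup>2"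
proof (rule power2_le_imp_le)
  define x where "x = 1 - (norm z)\<^sup>2"
  have x: "0 \<le> x" "x \<le> 1"
    using z by (auto simp: x_def abs_square_le_1 power_le_one)
  have "cnj z * (cnj t * z\<^sup>2) = (z * cnj z) * (cnj t * z)"
    by (simp add: power2_eq_square)
  also have "z * cnj z = complex_of_real ((norm z)\<^sup>2)"
    by (rule complex_norm_square[symmetric])
  finally have e: "cnj z * (cnj t * z\<^sup>2) = (norm z)\<^sup>2 * (cnj t * z)" .
  have "Re (cnj z * (cnj t * z\<^sup>2)) = (norm z)\<^sup>2 * Re (cnj z * t)"
    unfolding e by (simp add: algebra_simps)
  hence "Re (cnj z * (t - cnj t * z\<^sup>2)) = Re (cnj z * t) * x"
    by (simp only: x_def right_diff_distrib minus_complex.sel) simp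
  also have "\<dots> \<le> norm t * x"
  proof (rule mult_right_mono)
    have "Re (cnj z * t) \<le> norm (cnj z * t)" by (rule complex_Re_le_cmod)
    also have "\<dots> \<le> 1 * norm t"
      using z by (simp add: norm_mult mult_left_le_one_le)
    finally show "Re (cnj z * t) \<le> norm t" by simp
  qed (use x in auto)
  also have "\<dots> \<le> 1/2 * x"
    using t x by (intro mult_right_mono) auto
  finally have 1: "2 * Re (cnj z * (t - cnj t * z\<^sup>2)) \<le> x" by simp
  have "norm (cnj t * z\<^sup>2) \<le> norm t"
    using z by (simp add: norm_mult norm_power mult_left_le power_le_one)
  hence "norm (t - cnj t * z\<^sup>2) \<le> 2 * norm t"
    using norm_triangle_ineq4[of t "cnj t * z\<^sup>2"] by simp
  hence 2: "(norm (t - cnj t * z\<^sup>2))\<^sup>2 \<le> (2 * norm t)\<^sup>2"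
    by (intro power_mono) auto
  have "(norm (z + (t - cnj t * z\<^sup>2)))\<^sup>2 \<le> 1 + 4 * (norm t)\<^sup>2"
    unfolding norm_add_square using 1 2 by (simp add: x_def power_mult_distrib)
  also have "\<dots> \<le> (1 + 2 * (norm t)\<^sup>2)\<^sup>2"
    by (simp add: power2_eq_square algebra_simps)
  finally show "(norm (z + (t - cnj t * z\<^sup>2)))\<^sup>2 \<le> (1 + 2 * (norm t)\<^sup>2)\<^sup>2" .
qed simp

text \<open>
  The values \<open>u\<close> and \<open>q\<close> stand for \<open>L 1\<close> and \<open>L (f\<^sup>2)\<close> at a point where \<open>L f\<close> has the value
  \<open>g\<close>. If steps in all directions \<open>t\<close> leave the disc only to second order and \<open>g\<close> is close to the
  unit circle, then the field cannot point outwards at \<open>g\<close>, whatever the phase of \<open>t\<close>; this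
  forces \<open>cnj g * u\<close> and \<open>g * cnj q\<close> to be close.
\<close>
lemma tangency_defect:
  fixes g u q :: complex
  assumes g: "norm g \<le> 1" and \<tau>: "0 \<le> \<tau>" "\<tau> \<le> 1/2"
    and *: "\<And>t. norm t \<le> 1/2 \<Longrightarrow> norm (g + (t * u - cnj t * q)) \<le> 1 + 2 * (norm t)\<^sup>2"
  shows "2 * \<tau> * norm (cnj g * u - g * cnj q) \<le> 1 - (norm g)\<^sup>2 + 5 * \<tau>\<^sup>2"
proof -
  define D where "D = cnj g * u - g * cnj q"
  have g2: "(norm g)\<^sup>2 \<le> 1" using g by (simp add: power_le_one)
  have "2 * \<tau> * norm D \<le> 1 - (norm g)\<^sup>2 + 5 * \<tau>\<^sup>2"
  proof (cases "D = 0")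
    case False
    \<comment> \<open>the phase for which the first-order term points outwards as much as possible\<close>
    define t where "t = \<tau> * cnj (sgn D)"
    have nt: "norm t = \<tau>" using False \<tau> by (simp add: t_def norm_mult norm_sgn)
    have "t * D = \<tau> * (D * cnj D / norm D)"
      by (simp add: t_def complex_sgn_def scaleR_conv_of_real divide_simps sgn_div_norm)
    also have "D * cnj D = complex_of_real ((norm D)\<^sup>2)"
      by (rule complex_norm_square[symmetric])
    finally have tD: "t * D = complex_of_real (\<tau> * norm D)"
      using False by (simp add: power2_eq_square)
    have "Re (cnj g * (t * u - cnj t * q)) = Re (t * D)"
      by (simp add: D_def) (simp add: algebra_simps)
    hence "(norm g)\<^sup>2 + 2 * \<tau> * norm D \<le> (norm (g + (t * u - cnj t * q)))\<^sup>2"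
      unfolding norm_add_square tD by simp
    also have "\<dots> \<le> (1 + 2 * \<tau>\<^sup>2)\<^sup>2"
      using *[of t] nt \<tau> by (intro power_mono) auto
    also have "\<dots> = 1 + 4 * \<tau>\<^sup>2 + 4 * \<tau>\<^sup>2 * \<tau>\<^sup>2"
      by (simp add: power2_eq_square algebra_simps)
    also have "4 * \<tau>\<^sup>2 * \<tau>\<^sup>2 \<le> 1 * \<tau>\<^sup>2"
      using power_mono[OF \<tau>(2,1), of 2] by (intro mult_right_mono) (auto simp: power2_eq_square)
    finally show ?thesis by linarith
  qed (use g2 in auto)
  thus ?thesis by (simp add: D_def)
qed

text \<open>
  For \<open>u = 1\<close> the defect estimate shows that \<open>q - g\<^sup>2\<close> is almost tangent near the unit circle. At
  depth \<open>x = 1 - (norm g)\<^sup>2\<close> the defect is controlled by \<open>x\<close> plus a term of order \<open>t\<^sup>2\<close>, and the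
  room \<open>x\<close> left inside the disc pays for the former.
\<close>
lemma tangency_push:
  fixes g q :: complex
  assumes g: "norm g \<le> 1" and q: "norm q \<le> 1" and t: "0 \<le> t" "t \<le> 1/4"
    and *: "\<And>t. norm t \<le> 1/2 \<Longrightarrow> norm (g + (t - cnj t * q)) \<le> 1 + 2 * (norm t)\<^sup>2"
  shows "norm (g + t * (q - g * g)) \<le> 1 + 7 * t\<^sup>2"
proof (rule power2_le_imp_le)
  define x where "x = 1 - (norm g)\<^sup>2"
  have x: "0 \<le> x" "x \<le> 1" using g by (auto simp: x_def power_le_one)
  define D where "D = cnj g - g * cnj q"
  \<comment> \<open>doubling the step size halves the contribution of \<open>x\<close>\<close>
  have "2 * (2 * t) * norm D \<le> x + 5 * (2 * t)\<^sup>2"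
    using tangency_defect[of g "2 * t" 1 q] g t * by (simp add: x_def D_def)
  hence D: "2 * t * norm D \<le> x / 2 + 10 * t\<^sup>2"
    by (simp add: power_mult_distrib)
  have eq: "cnj g * (q - g * g) = - cnj D + g * x"
    unfolding D_def x_def of_real_diff of_real_power
    using complex_norm_square[of g] by (simp add: algebra_simps power2_eq_square)
  have "norm (cnj g * (q - g * g)) \<le> norm D + x"
    unfolding eq using norm_triangle_ineq[of "- cnj D" "g * x"] x g
      mult_right_mono[OF g, of x]
    by (simp add: norm_mult)
  hence "Re (cnj g * (q - g * g)) \<le> norm D + x"
    using complex_Re_le_cmod order_trans by blast
  hence "2 * t * Re (cnj g * (q - g * g)) \<le> 2 * t * (norm D + x)"
    using t by (intro mult_left_mono) auto
  also have "\<dots> \<le> x / 2 + 10 * t\<^sup>2 + 2 * (1/4) * x"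
    using D t x mult_right_mono[of t "1/4" x] by (simp add: distrib_left)
  finally have 1: "2 * (t * Re (cnj g * (q - g * g))) \<le> x + 10 * t\<^sup>2" by simp
  have "norm (q - g * g) \<le> 2"
    using norm_triangle_ineq4[of q "g * g"] q g mult_mono[OF g g] by (simp add: norm_mult)
  hence 2: "(t * norm (q - g * g))\<^sup>2 \<le> (t * 2)\<^sup>2"
    using t by (intro power_mono mult_left_mono) auto
  have "Re (cnj g * (t * (q - g * g))) = t * Re (cnj g * (q - g * g))"
    by (simp only: mult.left_commute[of "cnj g"]) simp
  hence "(norm (g + t * (q - g * g)))\<^sup>2 \<le> 1 + 14 * t\<^sup>2"
    unfolding norm_add_square using 1 2 t by (simp add: x_def norm_mult power_mult_distrib)
  also have "\<dots> \<le> (1 + 7 * t\<^sup>2)\<^sup>2"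
    using zero_le_power2[of "7 * t\<^sup>2"] by (simp add: power2_sum)
  finally show "(norm (g + t * (q - g * g)))\<^sup>2 \<le> (1 + 7 * t\<^sup>2)\<^sup>2" .
qed simp

section \<open>Coefficient estimates for polynomials and entire functions\<close>

text \<open>
  If \<open>p\<close> is the product of the factors \<open>1 - b * X\<close>, then the left-hand side is the norm of the
  sum of the squares \<open>b\<^sup>2\<close>, and each \<open>b\<close> is the reciprocal of a root.
\<close>
lemma power_sum_bound:
  fixes p :: "complex poly" and M :: real
  assumes "degree p \<le> n" "coeff p 0 = 1" "0 \<le> M"
    and "\<And>x. norm x * M < 1 \<Longrightarrow> poly p x \<noteq> 0"
  shows "norm ((coeff p 1)\<^sup>2 - 2 * coeff p 2) \<le> n * M\<^sup>2"
  using assms(1,2,4)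
proof (induction n arbitrary: p)
  case 0
  then show ?case by (simp add: coeff_eq_0)
next
  case (Suc n)
  show ?case
  proof (cases "degree p = 0")
    case True
    then show ?thesis using Suc.prems by (simp add: coeff_eq_0)
  next
    case False
    then obtain x where x: "poly p x = 0"
      using alg_closed_imp_poly_has_root[of p] by auto
    have x0: "x \<noteq> 0" using x Suc.prems(2) by (auto simp: poly_0_coeff_0)
    \<comment> \<open>split off the factor \<open>1 - b * X\<close>\<close>
    define b where "b = inverse x"
    have bx: "norm b \<le> M"
      using Suc.prems(3)[of x] x x0 by (force simp: b_def norm_inverse norm_divide field_simps not_less[symmetric])
    have "[:-x, 1:] dvd p" using x by (simp add: poly_eq_0_iff_dvd)
    then obtain s where s: "p = [:-x, 1:] * s" by (elim dvdE)
    define r where "r = smult (- x) s"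
    have p: "p = [:1, -b:] * r" using x0 by (simp add: s r_def b_def smult_add_right)
    have p0: "p \<noteq> 0" using Suc.prems(2) by auto
    have b0: "b \<noteq> 0" using x0 by (simp add: b_def)
    have r0: "r \<noteq> 0" using p p0 by auto
    have "degree p = Suc (degree r)"
      unfolding p using r0 b0 by (subst degree_mult_eq) auto
    hence dr: "degree r \<le> n" using Suc.prems(1) by simp
    have c: "coeff p 0 = coeff r 0" "coeff p 1 = coeff r 1 - b * coeff r 0"
        "coeff p 2 = coeff r 2 - b * coeff r 1"
      unfolding p by (simp_all add: coeff_pCons numeral_2_eq_2)
    have "norm ((coeff r 1)\<^sup>2 - 2 * coeff r 2) \<le> n * M\<^sup>2"
      using Suc.prems(2,3) c by (intro Suc.IH dr) (auto simp: p)
    moreover have "(coeff p 1)\<^sup>2 - 2 * coeff p 2 = ((coeff r 1)\<^sup>2 - 2 * coeff r 2) + b\<^sup>2"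
      unfolding c(2,3) using c(1) Suc.prems(2) by (simp add: power2_eq_square algebra_simps)
    hence "norm ((coeff p 1)\<^sup>2 - 2 * coeff p 2) \<le> norm ((coeff r 1)\<^sup>2 - 2 * coeff r 2) + norm (b\<^sup>2)"
      by (metis norm_triangle_ineq)
    moreover have "norm (b\<^sup>2) \<le> M\<^sup>2" using bx by (simp add: norm_power power_mono)
    ultimately show ?thesis by (simp add: distrib_right)
  qed
qed

text \<open>
  A Cauchy estimate for the second coefficient, obtained by two applications of the maximum
  principle.
\<close>
lemma second_coeff_bound:
  fixes R :: "complex \<Rightarrow> complex"
  assumes R: "R holomorphic_on UNIV"
    and b: "\<And>l. norm l = 1 \<Longrightarrow> norm (l * a + l\<^sup>2 * c + l^3 * R l) \<le> B"
  shows "norm c \<le> 2 * B"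
proof -
  have M: "norm (f 0) \<le> C"
    if "f holomorphic_on UNIV" "\<And>l. norm l = 1 \<Longrightarrow> norm (f l) \<le> C" for f :: "complex \<Rightarrow> complex" and C
  proof (rule maximum_modulus_frontier[of f "cball 0 1" _ 0])
    show "f holomorphic_on interior (cball 0 1)" using that(1) by (rule holomorphic_on_subset) auto
    show "continuous_on (closure (cball 0 1)) f"
      using that(1) holomorphic_on_imp_continuous_on continuous_on_subset by blast
  qed (use that in \<open>auto simp: dist_norm\<close>)
  have a: "norm a \<le> B"
  proof -
    have "norm (a + l * c + l\<^sup>2 * R l) \<le> B" if "norm l = 1" for l
    proof -
      have "norm (l * (a + l * c + l\<^sup>2 * R l)) \<le> B"
        using b[OF that] by (simp add: algebra_simps power2_eq_square power3_eq_cube)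
      thus ?thesis using that by (simp add: norm_mult)
    qed
    moreover have "(\<lambda>l. a + l * c + l\<^sup>2 * R l) holomorphic_on UNIV"
      using R by (intro holomorphic_intros)
    ultimately show ?thesis using M[of "\<lambda>l. a + l * c + l\<^sup>2 * R l" B] by simp
  qed
  have "norm (c + l * R l) \<le> 2 * B" if "norm l = 1" for l
  proof -
    have "l * a + l\<^sup>2 * c + l^3 * R l = l * a + l\<^sup>2 * (c + l * R l)"
      by (simp add: algebra_simps power2_eq_square power3_eq_cube)
    hence "norm (l\<^sup>2 * (c + l * R l)) \<le> norm (l * a + l\<^sup>2 * c + l^3 * R l) + norm (l * a)"
      by (metis add_diff_cancel_left' norm_triangle_ineq4)
    thus ?thesis using a b[OF that] that by (simp add: norm_mult norm_power)
  qed
  moreover have "(\<lambda>l. c + l * R l) holomorphic_on UNIV"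
    using R by (intro holomorphic_intros)
  ultimately show ?thesis using M[of "\<lambda>l. c + l * R l" "2 * B"] by simp
qed

section \<open>The algebra of bounded holomorphic functions and its operators\<close>

locale planar_domain =
  fixes \<Omega> :: "complex set"
  assumes open_domain: "open \<Omega>" and connected_domain: "connected \<Omega>" and nonempty: "\<Omega> \<noteq> {}"
begin

abbreviation "A \<equiv> H_infinity \<Omega>"
abbreviation "N \<equiv> sup_norm \<Omega>"

text \<open>Elements of the algebra vanish off \<open>\<Omega>\<close>, so constants have to be cut off there.\<close>
definition cst :: "complex \<Rightarrow> complex \<Rightarrow> complex" where
  "cst c = (\<lambda>z. if z \<in> \<Omega> then c else 0)"

lemma cst_apply [simp]: "z \<in> \<Omega> \<Longrightarrow> cst c z = c"
  by (simp add: cst_def)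

lemma A_I:
  assumes "f holomorphic_on \<Omega>" "\<And>z. z \<in> \<Omega> \<Longrightarrow> norm (f z) \<le> B" "\<And>z. z \<notin> \<Omega> \<Longrightarrow> f z = 0"
  shows "f \<in> A"
  using assms unfolding H_infinity_def bounded_iff by auto

lemma A_hol: "f \<in> A \<Longrightarrow> f holomorphic_on \<Omega>"
  and A_outside: "f \<in> A \<Longrightarrow> z \<notin> \<Omega> \<Longrightarrow> f z = 0"
  by (auto simp: H_infinity_def)

lemma A_eqI:
  assumes "f \<in> A" "g \<in> A" "\<And>z. z \<in> \<Omega> \<Longrightarrow> f z = g z"
  shows "f = g"
  using assms A_outside by (metis ext)

lemma norm_le_N: "f \<in> A \<Longrightarrow> z \<in> \<Omega> \<Longrightarrow> norm (f z) \<le> N f"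
  by (rule sup_norm_upper)

lemma N_le: "(\<And>z. z \<in> \<Omega> \<Longrightarrow> norm (f z) \<le> B) \<Longrightarrow> N f \<le> B"
  unfolding sup_norm_def using nonempty by (intro cSUP_least) auto

lemma N_nonneg: "f \<in> A \<Longrightarrow> 0 \<le> N f"
  using nonempty norm_le_N norm_ge_zero order_trans by blast

lemma A_cst: "cst c \<in> A"
  by (rule A_I[where B = "norm c"])
     (auto simp: cst_def intro: holomorphic_transform[OF holomorphic_on_const[of c]])

lemma A_add: "f \<in> A \<Longrightarrow> g \<in> A \<Longrightarrow> (\<lambda>z. f z + g z) \<in> A"
  by (rule A_I[where B = "N f + N g"])
     (auto intro!: holomorphic_intros norm_triangle_mono norm_le_N simp: A_outside A_hol)

lemma A_mult: "f \<in> A \<Longrightarrow> g \<in> A \<Longrightarrow> (\<lambda>z. f z * g z) \<in> A"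
  by (rule A_I[where B = "N f * N g"])
     (auto intro!: holomorphic_intros mult_mono norm_le_N N_nonneg simp: A_outside A_hol norm_mult)

lemma A_scale: "f \<in> A \<Longrightarrow> (\<lambda>z. c * f z) \<in> A"
  by (rule A_I[where B = "norm c * N f"])
     (auto intro!: holomorphic_intros mult_left_mono norm_le_N simp: A_outside A_hol norm_mult)

lemma A_diff: "f \<in> A \<Longrightarrow> g \<in> A \<Longrightarrow> (\<lambda>z. f z - g z) \<in> A"
  by (rule H_infinity_diff)

lemma A_sum: "(\<And>i. i \<in> I \<Longrightarrow> f i \<in> A) \<Longrightarrow> (\<lambda>z. \<Sum>i\<in>I. c i * f i z) \<in> A"
proof (induction I rule: infinite_finite_induct)
  case (insert i I)
  thus ?case using A_add[OF A_scale[of "f i" "c i"]] by simp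
qed (use A_cst[of 0] in \<open>simp_all add: cst_def\<close>)

text \<open>The factor \<open>cst 1\<close> matters for \<open>n = 0\<close>, where the power does not vanish off \<open>\<Omega>\<close>.\<close>
lemma A_power: "f \<in> A \<Longrightarrow> (\<lambda>z. cst 1 z * f z ^ n) \<in> A"
proof (induction n)
  case (Suc n)
  show ?case using A_mult[OF Suc.IH[OF Suc.prems] Suc.prems] by (simp add: ac_simps)
qed (simp add: A_cst)

lemma A_inverse:
  assumes "f \<in> A" "0 < c" "\<And>z. z \<in> \<Omega> \<Longrightarrow> c \<le> norm (f z)"
  shows "(\<lambda>z. inverse (f z)) \<in> A" "N (\<lambda>z. inverse (f z)) \<le> inverse c"
proof -
  have *: "norm (inverse (f z)) \<le> inverse c" if "z \<in> \<Omega>" for z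
    using assms(2) assms(3)[OF that] by (simp add: norm_inverse le_imp_inverse_le)
  show "N (\<lambda>z. inverse (f z)) \<le> inverse c" by (rule N_le[OF *])
  have "f z \<noteq> 0" if "z \<in> \<Omega>" for z using assms(2) assms(3)[OF that] by auto
  hence "(\<lambda>z. inverse (f z)) holomorphic_on \<Omega>"
    by (rule holomorphic_on_inverse[OF A_hol[OF assms(1)]])
  thus "(\<lambda>z. inverse (f z)) \<in> A"
    by (rule A_I[OF _ *]) (simp_all add: A_outside[OF assms(1)])
qed

lemma N_scale: "f \<in> A \<Longrightarrow> N (\<lambda>z. c * f z) = norm c * N f"
proof (rule antisym)
  assume f: "f \<in> A"
  show "N (\<lambda>z. c * f z) \<le> norm c * N f"
    by (rule N_le) (simp add: norm_mult mult_left_mono norm_le_N f)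
  show "norm c * N f \<le> N (\<lambda>z. c * f z)"
  proof (cases "c = 0")
    case False
    have "N f \<le> N (\<lambda>z. c * f z) / norm c"
      using False norm_le_N[OF A_scale[OF f, of c]]
      by (intro N_le) (simp add: field_simps norm_mult)
    thus ?thesis using False by (simp add: field_simps)
  qed (use N_nonneg[OF A_scale[OF f, of c]] in simp)
qed

lemma N_cst [simp]: "N (cst c) = norm c"
  unfolding sup_norm_def using nonempty by (simp add: cong: SUP_cong_simp)

lemma N_le_zero_imp_zero: "f \<in> A \<Longrightarrow> N f \<le> 0 \<Longrightarrow> f = cst 0"
proof (rule A_eqI[OF _ A_cst])
  fix z assume "f \<in> A" "N f \<le> 0" "z \<in> \<Omega>"
  thus "f z = cst 0 z" using norm_le_N[of f z] order_trans[of "norm (f z)" "N f" 0] by simp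
qed

lemma lin_in: "L \<in> linear_operators A \<Longrightarrow> f \<in> A \<Longrightarrow> L f \<in> A"
  and lin_add: "L \<in> linear_operators A \<Longrightarrow> f \<in> A \<Longrightarrow> g \<in> A \<Longrightarrow> L (\<lambda>z. f z + g z) = (\<lambda>z. L f z + L g z)"
  and lin_scale: "L \<in> linear_operators A \<Longrightarrow> f \<in> A \<Longrightarrow> L (\<lambda>z. c * f z) = (\<lambda>z. c * L f z)"
  by (auto simp: linear_operators_def)

lemma lin_diff:
  assumes L: "L \<in> linear_operators A" and f: "f \<in> A" and g: "g \<in> A"
  shows "L (\<lambda>z. f z - g z) = (\<lambda>z. L f z - L g z)"
  using lin_add[OF L f A_scale[OF g, of "-1"]] lin_scale[OF L g, of "-1"] by simp

lemma lin_zero: assumes "L \<in> linear_operators A" shows "L (cst 0) = cst 0"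
  using lin_scale[OF assms A_cst, of 0 0] by (simp add: cst_def)

lemma lin_sum:
  assumes L: "L \<in> linear_operators A" and "finite I" "\<And>i. i \<in> I \<Longrightarrow> f i \<in> A"
  shows "L (\<lambda>z. \<Sum>i\<in>I. c i * f i z) = (\<lambda>z. \<Sum>i\<in>I. c i * L (f i) z)"
  using assms(2,3)
proof (induction I)
  case empty
  thus ?case using lin_zero[OF L] by (simp add: cst_def)
next
  case (insert i I)
  have "L (\<lambda>z. c i * f i z + (\<Sum>i\<in>I. c i * f i z)) =
      (\<lambda>z. L (\<lambda>z. c i * f i z) z + L (\<lambda>z. \<Sum>i\<in>I. c i * f i z) z)"
    using insert.prems by (intro lin_add[OF L] A_scale A_sum) auto
  thus ?case using insert by (simp add: lin_scale[OF L])
qed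

lemma cst_mult: "f \<in> A \<Longrightarrow> (\<lambda>z. cst c z * f z) = (\<lambda>z. c * f z)"
  by (rule ext) (auto simp: cst_def A_outside)

lemma cst_eq_scale: "cst c = (\<lambda>z. c * cst 1 z)"
  by (auto simp: cst_def)

lemma lin_cst: "L \<in> linear_operators A \<Longrightarrow> L (cst c) = (\<lambda>z. c * L (cst 1) z)"
  using lin_scale[OF _ A_cst, of L c 1] cst_eq_scale[of c] by simp

text \<open>
  Polarization. The hypothesis concerns a single point, so that it can be supplied by a statement
  about the functional of evaluation at \<open>w\<close>.
\<close>
lemma mult_from_squares:
  assumes L: "L \<in> linear_operators A" and f: "f \<in> A" and g: "g \<in> A" and w: "w \<in> \<Omega>"
    and sq: "\<And>f. f \<in> A \<Longrightarrow> L (\<lambda>z. f z * f z) w = L f w * L f w"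
  shows "L (\<lambda>z. f z * g z) w = L f w * L g w"
proof -
  have e: "(\<lambda>z. (f z + g z) * (f z + g z)) =
      (\<lambda>z. (f z * f z + g z * g z) + 2 * (f z * g z))"
    by (simp add: algebra_simps)
  have "L (\<lambda>z. (f z + g z) * (f z + g z)) w = (L f w * L f w + L g w * L g w) + 2 * L (\<lambda>z. f z * g z) w"
    unfolding e using f g
    by (simp add: lin_add[OF L] lin_scale[OF L] A_add A_mult A_scale sq)
  moreover have "L (\<lambda>z. (f z + g z) * (f z + g z)) w = (L f w + L g w) * (L f w + L g w)"
    using sq[OF A_add[OF f g]] by (simp add: lin_add[OF L f g])
  ultimately show ?thesis by (simp add: algebra_simps)
qed

lemma Iso_lin: "L \<in> Iso A N \<Longrightarrow> L \<in> linear_operators A"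
  and Iso_norm: "L \<in> Iso A N \<Longrightarrow> f \<in> A \<Longrightarrow> N (L f) = N f"
  and Iso_surj: "L \<in> Iso A N \<Longrightarrow> L ` A = A"
  by (auto simp: Iso_def)

lemma isometry_inj:
  assumes L: "L \<in> linear_operators A" and n: "\<And>f. f \<in> A \<Longrightarrow> N (L f) = N f"
  shows "inj_on L A"
proof (rule inj_onI)
  fix f g assume fg: "f \<in> A" "g \<in> A" "L f = L g"
  have "L (\<lambda>z. f z - g z) = cst 0" using fg lin_diff[OF L] by (simp add: cst_def)
  hence "N (\<lambda>z. f z - g z) = 0" using n[OF A_diff[OF fg(1,2)]] by simp
  hence "(\<lambda>z. f z - g z) = cst 0" using N_le_zero_imp_zero[OF A_diff] fg by simp
  hence "f z - g z = 0" for z by (metis cst_def)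
  thus "f = g" by auto
qed

lemma scaled_lin:
  assumes L: "L \<in> linear_operators A"
  shows "restrict (\<lambda>f z. c * L f z) A \<in> linear_operators A"
  using lin_in[OF L] lin_add[OF L] lin_scale[OF L] unfolding linear_operators_def
  by (auto simp: A_add A_scale algebra_simps)

lemma Iso_scaled:
  assumes L: "L \<in> Iso A N" and c: "norm c = 1"
  shows "restrict (\<lambda>f z. c * L f z) A \<in> Iso A N"
proof -
  note lin = Iso_lin[OF L]
  have "g \<in> restrict (\<lambda>f z. c * L f z) A ` A" if g: "g \<in> A" for g
  proof -
    obtain f where f: "f \<in> A" "L f = (\<lambda>z. inverse c * g z)"
      using A_scale[OF g] Iso_surj[OF L] by (metis imageE)
    have "c \<noteq> 0" using c by auto
    hence "restrict (\<lambda>f z. c * L f z) A f = g"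
      using f by (simp add: mult.assoc[symmetric])
    thus ?thesis using f(1) by blast
  qed
  moreover have "N (restrict (\<lambda>f z. c * L f z) A f) = N f" if "f \<in> A" for f
    using that N_scale[OF lin_in[OF lin that], of c] c Iso_norm[OF L that] by simp
  ultimately show ?thesis
    using scaled_lin[OF lin, of c] lin_in[OF scaled_lin[OF lin, of c]]
    unfolding Iso_def by blast
qed

lemma Iso_inverse:
  assumes L: "L \<in> Iso A N"
  obtains W where "W \<in> Iso A N" "\<And>f. f \<in> A \<Longrightarrow> W (L f) = f" "\<And>f. f \<in> A \<Longrightarrow> L (W f) = f"
proof -
  note lin = Iso_lin[OF L]
  have inj: "inj_on L A" using isometry_inj[OF lin] Iso_norm[OF L] by blast
  define W where "W = restrict (inv_into A L) A"
  have WL: "W (L f) = f" if "f \<in> A" for f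
    using that inj lin_in[OF lin that] by (simp add: W_def)
  have LW: "L (W f) = f" and WA: "W f \<in> A" if "f \<in> A" for f
    using that Iso_surj[OF L] by (auto simp: W_def f_inv_into_f inv_into_into)
  have WI: "W g = f" if "f \<in> A" "L f = g" for f g using WL that by auto
  have "W \<in> linear_operators A"
    unfolding linear_operators_def
  proof (intro CollectI conjI ballI allI)
    show "W \<in> A \<rightarrow>\<^sub>E A" using WA by (auto simp: W_def)
    show "W (\<lambda>x. f x + g x) = (\<lambda>x. W f x + W g x)" if "f \<in> A" "g \<in> A" for f g
      using that by (intro WI A_add WA) (simp_all add: lin_add[OF lin] WA LW)
    show "W (\<lambda>x. c * f x) = (\<lambda>x. c * W f x)" if "f \<in> A" for f c
      using that by (intro WI A_scale WA) (simp_all add: lin_scale[OF lin] WA LW)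
  qed
  moreover have "W ` A = A" using WL lin_in[OF lin] WA by (auto simp: image_iff) metis
  moreover have "N (W f) = N f" if "f \<in> A" for f using Iso_norm[OF L WA[OF that]] LW[OF that] by simp
  ultimately have "W \<in> Iso A N" by (auto simp: Iso_def)
  thus ?thesis using that WL LW by blast
qed

section \<open>Isometries map the unit to a unimodular constant\<close>

text \<open>
  The estimate of a step along \<open>t - cnj t * f\<^sup>2\<close> is one of sup norms, so an isometry
  transports it to the images.
\<close>
lemma Iso_disc_field:
  assumes L: "L \<in> Iso A N" and f: "f \<in> A" "N f \<le> 1" and w: "w \<in> \<Omega>" and t: "norm t \<le> 1/2"
  shows "norm (L f w + (t * L (cst 1) w - cnj t * L (\<lambda>z. f z * f z) w)) \<le> 1 + 2 * (norm t)\<^sup>2"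
proof -
  note lin = Iso_lin[OF L]
  define h where "h = (\<lambda>z. f z + (t * cst 1 z - cnj t * (f z * f z)))"
  have h: "h \<in> A" unfolding h_def by (intro A_add A_diff A_scale A_mult A_cst f)
  have Lh: "L h = (\<lambda>z. L f z + (t * L (cst 1) z - cnj t * L (\<lambda>z. f z * f z) z))"
    unfolding h_def
    by (simp add: lin_add[OF lin] lin_diff[OF lin] lin_scale[OF lin] A_add A_diff A_scale A_mult A_cst f)
  have "N h \<le> 1 + 2 * (norm t)\<^sup>2"
  proof (rule N_le)
    fix z assume z: "z \<in> \<Omega>"
    have "norm (f z) \<le> 1" using norm_le_N[OF f(1) z] f(2) by simp
    thus "norm (h z) \<le> 1 + 2 * (norm t)\<^sup>2"
      using disc_field_bound[of "f z" t] t z by (simp add: h_def power2_eq_square)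
  qed
  thus ?thesis
    using norm_le_N[OF lin_in[OF lin h] w] Iso_norm[OF L h] by (simp add: Lh)
qed

text \<open>
  Both \<open>f + g\<close> and \<open>\<i> * (f - g)\<close> are holomorphic and real-valued, hence constant by the open
  mapping theorem.
\<close>
lemma holomorphic_cnj_imp_constant:
  assumes "f holomorphic_on \<Omega>" "g holomorphic_on \<Omega>" "\<And>z. z \<in> \<Omega> \<Longrightarrow> g z = cnj (f z)"
  shows "f constant_on \<Omega>"
proof -
  have real_const: "h constant_on \<Omega>" if h: "h holomorphic_on \<Omega>" "\<And>z. z \<in> \<Omega> \<Longrightarrow> Im (h z) = 0" for h
  proof (rule ccontr)
    assume "\<not> h constant_on \<Omega>"
    hence "open (h ` \<Omega>)"
      using open_mapping_thm[OF h(1) open_domain connected_domain open_domain] by blast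
    moreover obtain w where w: "w \<in> \<Omega>" using nonempty by blast
    ultimately obtain e where e: "0 < e" "ball (h w) e \<subseteq> h ` \<Omega>"
      by (meson openE image_eqI)
    have "h w + \<i> * of_real (e / 2) \<in> ball (h w) e"
      using e by (simp add: dist_norm norm_mult)
    hence "h w + \<i> * of_real (e / 2) \<in> h ` \<Omega>" using e by blast
    then obtain z where "z \<in> \<Omega>" "h z = h w + \<i> * of_real (e / 2)" by (metis imageE)
    hence "Im (h w + \<i> * of_real (e / 2)) = 0" using h(2) by metis
    thus False using h(2)[OF w] e by simp
  qed
  have "(\<lambda>z. f z + g z) constant_on \<Omega>" "(\<lambda>z. \<i> * (f z - g z)) constant_on \<Omega>"
    using assms by (auto intro!: real_const holomorphic_intros)
  then obtain a b where ab: "\<And>z. z \<in> \<Omega> \<Longrightarrow> f z + g z = a" "\<And>z. z \<in> \<Omega> \<Longrightarrow> \<i> * (f z - g z) = b"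
    unfolding constant_on_def by meson
  have "f z = (a - \<i> * b) / 2" if "z \<in> \<Omega>" for z
    unfolding ab(1)[OF that, symmetric] ab(2)[OF that, symmetric] by (simp add: right_diff_distrib)
  thus ?thesis unfolding constant_on_def by blast
qed

text \<open>
  Apply the transported estimate to the preimage \<open>f\<close> of the constant \<open>1\<close>. All values of \<open>L f\<close>
  lie on the unit circle, so there is no room left, and the defect vanishes everywhere: \<open>L 1\<close> is
  the complex conjugate of \<open>L (f\<^sup>2)\<close>.
\<close>
lemma Iso_one:
  assumes L: "L \<in> Iso A N"
  obtains u where "norm u = 1" "L (cst 1) = cst u"
proof -
  note lin = Iso_lin[OF L]
  obtain f where f: "f \<in> A" "L f = cst 1" using Iso_surj[OF L] A_cst by (metis imageE)
  have Nf: "N f \<le> 1" using Iso_norm[OF L f(1)] f(2) by simp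
  define q where "q = L (\<lambda>z. f z * f z)"
  have eq: "q w = cnj (L (cst 1) w)" if w: "w \<in> \<Omega>" for w
  proof -
    define d where "d = norm (L (cst 1) w - cnj (q w))"
    have *: "2 * \<tau> * d \<le> 5 * \<tau>\<^sup>2" if "0 \<le> \<tau>" "\<tau> \<le> 1/2" for \<tau>
      using tangency_defect[of 1 \<tau> "L (cst 1) w" "q w"] that
        Iso_disc_field[OF L f(1) Nf w] f(2) w by (simp add: d_def q_def)
    hence le: "d \<le> 5/2 * \<tau>" if "0 < \<tau>" "\<tau> \<le> 1/2" for \<tau>
    proof -
      have "\<tau> * (2 * d) \<le> \<tau> * (5 * \<tau>)"
        using *[of \<tau>] that by (simp add: power2_eq_square algebra_simps)
      thus ?thesis using that by simp
    qed
    have "d \<le> 0"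
    proof (rule field_le_epsilon)
      fix e :: real assume "0 < e"
      hence "d \<le> 5/2 * min (1/2) (e / 5)" by (intro le) auto
      also have "\<dots> \<le> 5/2 * (e / 5)" by (intro mult_left_mono) auto
      finally show "d \<le> 0 + e" using \<open>0 < e\<close> by simp
    qed
    thus ?thesis by (simp add: d_def)
  qed
  have "L (cst 1) constant_on \<Omega>"
    using eq by (intro holomorphic_cnj_imp_constant[of _ q])
      (auto simp: q_def intro!: A_hol lin_in[OF lin] A_cst A_mult f)
  then obtain u where "\<And>z. z \<in> \<Omega> \<Longrightarrow> L (cst 1) z = u" unfolding constant_on_def by blast
  hence u: "L (cst 1) = cst u" by (intro A_eqI A_cst lin_in[OF lin]) auto
  have "norm u = 1" using Iso_norm[OF L A_cst, of 1] u by simp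
  thus ?thesis using that u by blast
qed

section \<open>Tangent quadratic vector fields vanish\<close>

text \<open>
  Functions of a scalar variable \<open>l\<close> with values in the algebra, built from finitely many
  elements with entire coefficients. In this inductive form, closure under bilinear maps is an
  induction, and no analysis of vector-valued functions is involved.
\<close>
inductive_set entire_family :: "(complex \<Rightarrow> complex \<Rightarrow> complex) set" where
  const: "a \<in> A \<Longrightarrow> (\<lambda>l. a) \<in> entire_family"
| mult: "q holomorphic_on UNIV \<Longrightarrow> G \<in> entire_family \<Longrightarrow> (\<lambda>l z. q l * G l z) \<in> entire_family"
| add: "G \<in> entire_family \<Longrightarrow> H \<in> entire_family \<Longrightarrow> (\<lambda>l z. G l z + H l z) \<in> entire_family"

lemma entire_family_in: "G \<in> entire_family \<Longrightarrow> G l \<in> A"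
  by (induction rule: entire_family.induct) (auto intro: A_scale A_add)

lemma entire_family_hol: "G \<in> entire_family \<Longrightarrow> (\<lambda>l. G l w) holomorphic_on UNIV"
  by (induction rule: entire_family.induct) (auto intro!: holomorphic_intros)

definition bilinear_on_A where
  "bilinear_on_A p \<longleftrightarrow>
     (\<forall>f\<in>A. \<forall>g\<in>A. p f g \<in> A) \<and>
     (\<forall>f\<in>A. \<forall>f'\<in>A. \<forall>g\<in>A. p (\<lambda>z. f z + f' z) g = (\<lambda>z. p f g z + p f' g z)) \<and>
     (\<forall>f\<in>A. \<forall>g\<in>A. \<forall>g'\<in>A. p f (\<lambda>z. g z + g' z) = (\<lambda>z. p f g z + p f g' z)) \<and>
     (\<forall>c. \<forall>f\<in>A. \<forall>g\<in>A. p (\<lambda>z. c * f z) g = (\<lambda>z. c * p f g z) \<and>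
                       p f (\<lambda>z. c * g z) = (\<lambda>z. c * p f g z))"

context
  fixes p :: "(complex \<Rightarrow> complex) \<Rightarrow> (complex \<Rightarrow> complex) \<Rightarrow> complex \<Rightarrow> complex"
  assumes p: "bilinear_on_A p"
begin

lemma p_in: "f \<in> A \<Longrightarrow> g \<in> A \<Longrightarrow> p f g \<in> A"
  and p_addl: "f \<in> A \<Longrightarrow> f' \<in> A \<Longrightarrow> g \<in> A \<Longrightarrow> p (\<lambda>z. f z + f' z) g = (\<lambda>z. p f g z + p f' g z)"
  and p_addr: "f \<in> A \<Longrightarrow> g \<in> A \<Longrightarrow> g' \<in> A \<Longrightarrow> p f (\<lambda>z. g z + g' z) = (\<lambda>z. p f g z + p f g' z)"
  and p_scalel: "f \<in> A \<Longrightarrow> g \<in> A \<Longrightarrow> p (\<lambda>z. c * f z) g = (\<lambda>z. c * p f g z)"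
  and p_scaler: "f \<in> A \<Longrightarrow> g \<in> A \<Longrightarrow> p f (\<lambda>z. c * g z) = (\<lambda>z. c * p f g z)"
  using p by (auto simp: bilinear_on_A_def)

lemma entire_family_bilinear:
  assumes "G \<in> entire_family" "H \<in> entire_family"
  shows "(\<lambda>l. p (G l) (H l)) \<in> entire_family"
  using assms(1)
proof (induction rule: entire_family.induct)
  case (const a)
  show ?case using assms(2)
    by (induction rule: entire_family.induct)
       (auto simp: const p_addr p_scaler entire_family_in intro!: entire_family.intros p_in)
next
  case (mult q G)
  thus ?case using entire_family.mult[OF mult.hyps(1) mult.IH]
    by (simp add: p_scalel entire_family_in assms(2))
next
  case (add G G')
  thus ?case using entire_family.add[OF add.IH]
    by (simp add: p_addl entire_family_in assms(2))
qed

text \<open>One Euler step of size \<open>t\<close> along the quadratic vector field \<open>f \<mapsto> p f f\<close>.\<close>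
definition euler_step :: "real \<Rightarrow> (complex \<Rightarrow> complex) \<Rightarrow> complex \<Rightarrow> complex" where
  "euler_step t f = (\<lambda>z. f z + t * p f f z)"

lemma euler_step_in: "f \<in> A \<Longrightarrow> euler_step t f \<in> A"
  unfolding euler_step_def by (intro A_add A_scale p_in)

text \<open>
  The field has no linear part, so \<open>k\<close> steps of size \<open>t\<close> add up in the second-order coefficient.
\<close>
lemma euler_iterate_expansion:
  assumes g: "g \<in> A"
  shows "\<exists>R\<in>entire_family. \<forall>l. (euler_step t ^^ k) (\<lambda>z. l * g z) =
           (\<lambda>z. l * g z + l\<^sup>2 * (complex_of_real (k * t) * p g g z) + l^3 * R l z)"
proof (induction k)
  case 0
  have "(\<lambda>l z. 0 * g z) \<in> entire_family"
    by (intro entire_family.mult entire_family.const g holomorphic_intros)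
  thus ?case by (intro bexI[of _ "\<lambda>l z. 0 * g z"]) simp_all
next
  case (Suc k)
  then obtain R where R: "R \<in> entire_family"
    and eq: "\<And>l. (euler_step t ^^ k) (\<lambda>z. l * g z) =
           (\<lambda>z. l * g z + l\<^sup>2 * (complex_of_real (k * t) * p g g z) + l^3 * R l z)" by blast
  note gg = p_in[OF g g]
  define H where "H = (\<lambda>l z. complex_of_real (k * t) * p g g z + l * R l z)"
  have H: "H \<in> entire_family" unfolding H_def
    by (rule entire_family.add[OF entire_family.mult[OF holomorphic_on_const entire_family.const[OF gg]]
          entire_family.mult[OF holomorphic_on_id[unfolded id_def] R]])
  note HA = entire_family_in[OF H]
  define S where "S = (\<lambda>l z. (p g (H l) z + p (H l) g z) + l * p (H l) (H l) z)"
  have S: "S \<in> entire_family" unfolding S_def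
    by (rule entire_family.add[OF entire_family.add[OF entire_family_bilinear[OF entire_family.const[OF g] H]
              entire_family_bilinear[OF H entire_family.const[OF g]]]
          entire_family.mult[OF holomorphic_on_id[unfolded id_def] entire_family_bilinear[OF H H]]])
  define R' where "R' = (\<lambda>l z. R l z + complex_of_real t * S l z)"
  have R': "R' \<in> entire_family" unfolding R'_def
    by (rule entire_family.add[OF R entire_family.mult[OF holomorphic_on_const S]])
  have "(euler_step t ^^ Suc k) (\<lambda>z. l * g z) =
      (\<lambda>z. l * g z + l\<^sup>2 * (complex_of_real (Suc k * t) * p g g z) + l^3 * R' l z)" for l
  proof -
    have eqH: "(euler_step t ^^ k) (\<lambda>z. l * g z) = (\<lambda>z. l * g z + l\<^sup>2 * H l z)"
      unfolding eq H_def by (rule ext) (simp add: algebra_simps power2_eq_square power3_eq_cube)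
    have "p (\<lambda>z. l * g z + l\<^sup>2 * H l z) (\<lambda>z. l * g z + l\<^sup>2 * H l z) =
        (\<lambda>z. l * (l * p g g z) + l * (l\<^sup>2 * p g (H l) z) +
              (l\<^sup>2 * (l * p (H l) g z) + l\<^sup>2 * (l\<^sup>2 * p (H l) (H l) z)))"
      using g HA[of l] by (simp add: p_addl p_addr p_scalel p_scaler A_add A_scale)
    hence "(euler_step t ^^ Suc k) (\<lambda>z. l * g z) = (\<lambda>z. l * g z + l\<^sup>2 * H l z + t *
        (l * (l * p g g z) + l * (l\<^sup>2 * p g (H l) z) +
              (l\<^sup>2 * (l * p (H l) g z) + l\<^sup>2 * (l\<^sup>2 * p (H l) (H l) z))))"
      by (simp add: eqH) (simp add: euler_step_def)
    also have "\<dots> = (\<lambda>z. l * g z + l\<^sup>2 * (complex_of_real (Suc k * t) * p g g z) + l^3 * R' l z)"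
      unfolding R'_def S_def 
      by (rule ext) (simp add: H_def algebra_simps power2_eq_square power3_eq_cube)
    finally show ?thesis .
  qed
  thus ?case using R' by blast
qed

text \<open>
  Cartan's uniqueness argument for the flow of the field, with Euler steps in place of the flow.
  With \<open>m\<^sup>2\<close> steps of size \<open>t = 1 / (8 * m)\<close> the total growth of the norm is at most
  \<open>(1 + 28 * t\<^sup>2) ^ m\<^sup>2 \<le> 2\<close>, while the second-order coefficient is \<open>m / 8\<close> times the field.
  By the Cauchy estimate this multiple stays bounded as \<open>m\<close> tends to infinity.
\<close>
lemma quadratic_field_vanishes:
  assumes bound: "\<And>g t. g \<in> A \<Longrightarrow> N g \<le> 1 \<Longrightarrow> 0 \<le> t \<Longrightarrow> t \<le> 1/4 \<Longrightarrow>
      N (euler_step t g) \<le> 1 + 7 * t\<^sup>2"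
    and g: "g \<in> A" "N g \<le> 1" and w: "w \<in> \<Omega>"
  shows "p g g w = 0"
proof (rule ccontr)
  assume nz: "p g g w \<noteq> 0"
  \<comment> \<open>rescaling by \<open>R\<close> turns a step of size \<open>t\<close> from the ball of radius \<open>R\<close> into one of
    size \<open>t * R\<close> from the unit ball; \<open>28\<close> is \<open>7 * 2\<^sup>2\<close>\<close>
  have step: "N (euler_step t f) \<le> R * (1 + 28 * t\<^sup>2)"
    if f: "f \<in> A" "N f \<le> R" and R: "1 \<le> R" "R \<le> 2" and t: "0 \<le> t" "t \<le> 1/8" for f R t
  proof -
    define f' where "f' = (\<lambda>z. inverse (complex_of_real R) * f z)"
    have f': "f' \<in> A" unfolding f'_def by (rule A_scale[OF f(1)])
    have Nf': "N f' \<le> 1" unfolding f'_def N_scale[OF f(1)]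
      using f R by (simp add: norm_inverse norm_divide field_simps)
    have ff': "f = (\<lambda>z. R * f' z)" unfolding f'_def using R by (auto simp: fun_eq_iff)
    have "euler_step t f = (\<lambda>z. R * euler_step (t * R) f' z)"
      unfolding euler_step_def
      by (subst (1 2 3) ff') (simp add: p_scalel p_scaler f' A_scale algebra_simps)
    hence "N (euler_step t f) = R * N (euler_step (t * R) f')"
      using N_scale[OF euler_step_in[OF f']] R by simp
    also have "\<dots> \<le> R * (1 + 7 * (t * R)\<^sup>2)"
      using R t mult_mono[of t "1/8" R 2] by (intro mult_left_mono bound f' Nf') auto
    also have "\<dots> \<le> R * (1 + 28 * t\<^sup>2)"
    proof -
      have "(t * R)\<^sup>2 \<le> (t * 2)\<^sup>2" using R t by (intro power_mono mult_left_mono) auto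
      thus ?thesis using R by (intro mult_left_mono) (auto simp: power_mult_distrib algebra_simps)
    qed
    finally show ?thesis .
  qed
  have bounded: "m / 8 * norm (p g g w) \<le> 4" if m: "0 < m" for m :: nat
  proof -
    define t where "t = 1 / (8 * real m)"
    have t: "0 \<le> t" "t \<le> 1/8" using m by (auto simp: t_def field_simps)
    define q where "q = 1 + 28 * t\<^sup>2"
    have q1: "1 \<le> q" by (simp add: q_def)
    have q2: "q ^ k \<le> 2" if "k \<le> m\<^sup>2" for k
    proof -
      have "q ^ k \<le> q ^ (m\<^sup>2)" using that q1 by (rule power_increasing)
      also have "\<dots> \<le> exp (28 * t\<^sup>2) ^ (m\<^sup>2)"
        unfolding q_def by (intro power_mono) (auto simp: add_nonneg_nonneg)
      also have "\<dots> = exp (real (m\<^sup>2) * (28 * t\<^sup>2))" by (rule exp_of_nat_mult[symmetric])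
      also have "real (m\<^sup>2) * (28 * t\<^sup>2) = 28 / 64"
        using m by (simp add: t_def power2_eq_square)
      also have "exp (28 / 64) \<le> exp (1 / 2 :: real)" by simp
      also have "\<dots> \<le> 2" by (rule exp_half_le2)
      finally show ?thesis .
    qed
    have iter: "(euler_step t ^^ k) (\<lambda>z. l * g z) \<in> A \<and> N ((euler_step t ^^ k) (\<lambda>z. l * g z)) \<le> q ^ k"
      if "k \<le> m\<^sup>2" "norm l = 1" for k l
      using that(1)
    proof (induction k)
      case 0
      thus ?case using g that(2) by (simp add: A_scale N_scale)
    next
      case (Suc k)
      have "N (euler_step t ((euler_step t ^^ k) (\<lambda>z. l * g z))) \<le> q ^ k * (1 + 28 * t\<^sup>2)"
        using Suc q1 q2 t by (intro step) auto
      thus ?case using Suc by (simp add: q_def euler_step_in mult.commute)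
    qed
    obtain R where R: "R \<in> entire_family"
      and eq: "\<And>l. (euler_step t ^^ (m\<^sup>2)) (\<lambda>z. l * g z) =
           (\<lambda>z. l * g z + l\<^sup>2 * (complex_of_real (real (m\<^sup>2) * t) * p g g z) + l^3 * R l z)"
      using euler_iterate_expansion[OF g(1), where t = t and k = "m\<^sup>2"] by blast
    have "norm (complex_of_real (real (m\<^sup>2) * t) * p g g w) \<le> 2 * 2"
    proof (rule second_coeff_bound[OF entire_family_hol[OF R]])
      fix l :: complex assume l: "norm l = 1"
      have "norm ((euler_step t ^^ (m\<^sup>2)) (\<lambda>z. l * g z) w) \<le> 2"
        using iter[OF order_refl l] q2[OF order_refl] norm_le_N[OF _ w] by (meson order_trans)
      thus "norm (l * g w + l\<^sup>2 * (complex_of_real (real (m\<^sup>2) * t) * p g g w) + l^3 * R l w) \<le> 2"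
        unfolding eq .
    qed
    moreover have "real (m\<^sup>2) * t = m / 8" using m by (simp add: t_def power2_eq_square)
    ultimately show ?thesis by (simp only: norm_mult norm_of_real)
  qed
  obtain m :: nat where m: "32 < m * norm (p g g w)"
    using reals_Archimedean3[of "norm (p g g w)"] nz by auto
  hence "0 < m" by (cases m) auto
  thus False using bounded[of m] m by simp
qed

end

section \<open>Surjective isometries are multiplicative\<close>

text \<open>
  The field \<open>p g g = V ((W g)\<^sup>2) - g\<^sup>2\<close>, with \<open>W\<close> the inverse of \<open>V\<close>, is the difference of
  two Moebius fields, the pointwise one and its conjugate under \<open>V\<close>, up to sign. It is tangent to the
  unit sphere by \<open>tangency_push\<close>.
\<close>
lemma Iso_unital_square:
  assumes V: "V \<in> Iso A N" and V1: "V (cst 1) = cst 1" and f: "f \<in> A" and w: "w \<in> \<Omega>"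
  shows "V (\<lambda>z. f z * f z) w = V f w * V f w"
proof -
  note Vlin = Iso_lin[OF V]
  obtain W where W: "W \<in> Iso A N" and WV: "\<And>f. f \<in> A \<Longrightarrow> W (V f) = f"
    and VW: "\<And>f. f \<in> A \<Longrightarrow> V (W f) = f" using Iso_inverse[OF V] by metis
  note Wlin = Iso_lin[OF W] note WA = lin_in[OF Wlin]
  define p where "p = (\<lambda>g h z. V (\<lambda>z. W g z * W h z) z - g z * h z)"
  have bil: "bilinear_on_A p"
    unfolding bilinear_on_A_def
  proof (intro conjI ballI allI)
    show "p f g \<in> A" if "f \<in> A" "g \<in> A" for f g
      unfolding p_def using that by (intro A_diff A_mult lin_in[OF Vlin] WA)
    show "p (\<lambda>z. f z + f' z) g = (\<lambda>z. p f g z + p f' g z)" if "f \<in> A" "f' \<in> A" "g \<in> A" for f f' g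
      unfolding p_def using that
      by (simp add: lin_add[OF Wlin] distrib_right lin_add[OF Vlin] A_mult WA) (simp add: algebra_simps)
    show "p f (\<lambda>z. g z + g' z) = (\<lambda>z. p f g z + p f g' z)" if "f \<in> A" "g \<in> A" "g' \<in> A" for f g g'
      unfolding p_def using that
      by (simp add: lin_add[OF Wlin] distrib_left lin_add[OF Vlin] A_mult WA) (simp add: algebra_simps)
    show "p (\<lambda>z. c * f z) g = (\<lambda>z. c * p f g z)" if "f \<in> A" "g \<in> A" for c f g
      unfolding p_def using that
      by (simp add: lin_scale[OF Wlin] mult.assoc lin_scale[OF Vlin] A_mult WA right_diff_distrib)
    show "p f (\<lambda>z. c * g z) = (\<lambda>z. c * p f g z)" if "f \<in> A" "g \<in> A" for c f g
      unfolding p_def using that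
      by (simp add: lin_scale[OF Wlin] mult.left_commute[of _ c] lin_scale[OF Vlin] A_mult WA right_diff_distrib)
  qed
  have bound: "N (euler_step p t g) \<le> 1 + 7 * t\<^sup>2"
    if g: "g \<in> A" "N g \<le> 1" and t: "0 \<le> t" "t \<le> 1/4" for g and t :: real
  proof (rule N_le)
    fix z assume z: "z \<in> \<Omega>"
    define h where "h = W g"
    have h: "h \<in> A" "N h \<le> 1" "V h = g"
      using g WA VW Iso_norm[OF W] by (auto simp: h_def)
    define q where "q = V (\<lambda>z. h z * h z)"
    have hh: "(\<lambda>z. h z * h z) \<in> A" by (intro A_mult h)
    have "N (\<lambda>z. h z * h z) \<le> 1"
    proof (rule N_le)
      fix z assume "z \<in> \<Omega>"
      hence "norm (h z) \<le> 1" using norm_le_N[OF h(1)] h(2) order_trans by blast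
      thus "norm (h z * h z) \<le> 1" using mult_mono[of "norm (h z)" 1 "norm (h z)" 1] by (simp add: norm_mult)
    qed
    hence "norm (q z) \<le> 1"
      using norm_le_N[OF lin_in[OF Vlin hh] z] Iso_norm[OF V hh] by (simp add: q_def)
    moreover have "norm (g z) \<le> 1" using norm_le_N[OF g(1) z] g(2) by simp
    moreover have "norm (g z + (t - cnj t * q z)) \<le> 1 + 2 * (norm t)\<^sup>2" if "norm t \<le> 1/2" for t
      using Iso_disc_field[OF V h(1,2) z that] z by (simp add: h(3) V1 q_def)
    ultimately have "norm (g z + t * (q z - g z * g z)) \<le> 1 + 7 * t\<^sup>2"
      using t by (intro tangency_push)
    thus "norm (euler_step p t g z) \<le> 1 + 7 * t\<^sup>2"
      unfolding euler_step_def[OF bil] by (simp add: p_def q_def h_def)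
  qed
  \<comment> \<open>scale into the unit ball; adding \<open>1\<close> avoids dividing by zero for \<open>f = 0\<close>\<close>
  define s where "s = complex_of_real (inverse (N f + 1))"
  have Nf: "0 \<le> N f" using N_nonneg[OF f] .
  have ns: "norm s = inverse (N f + 1)" unfolding s_def norm_of_real using Nf by simp
  have s: "s \<noteq> 0" using ns Nf by auto
  have sN: "norm s * N f \<le> 1" unfolding ns using Nf by (simp add: field_simps)
  define g where "g = (\<lambda>z. s * V f z)"
  have Vf: "V f \<in> A" by (rule lin_in[OF Vlin f])
  have g: "g \<in> A" "N g \<le> 1"
    using sN Iso_norm[OF V f] by (auto simp: g_def A_scale[OF Vf] N_scale[OF Vf])
  have "p g g w = 0" by (rule quadratic_field_vanishes[OF bil bound g w])
  hence "p (V f) (V f) w = 0"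
    using bil Vf s unfolding bilinear_on_A_def g_def by (simp add: A_scale)
  thus ?thesis by (simp add: p_def WV f)
qed

lemma Iso_multiplicative:
  assumes L: "L \<in> Iso A N" and L1: "L (cst 1) = cst u" and f: "f \<in> A" and g: "g \<in> A" and w: "w \<in> \<Omega>"
  shows "u * L (\<lambda>z. f z * g z) w = L f w * L g w"
proof -
  have "N (cst u) = N (cst 1)" using Iso_norm[OF L A_cst, of 1] L1 by simp
  hence nu: "norm u = 1" by simp
  hence uu: "cnj u * u = 1" using complex_norm_square[of u] by (simp add: mult.commute)
  define V where "V = restrict (\<lambda>f z. cnj u * L f z) A"
  have V: "V \<in> Iso A N" unfolding V_def using L nu by (intro Iso_scaled) auto
  have V1: "V (cst 1) = cst 1"
    unfolding V_def using uu by (simp add: L1 A_cst) (auto simp: cst_def)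
  have "V (\<lambda>z. f z * g z) w = V f w * V g w"
    by (rule mult_from_squares[OF Iso_lin[OF V] f g w]) (rule Iso_unital_square[OF V V1 _ w])
  hence "cnj u * L (\<lambda>z. f z * g z) w = (cnj u * L f w) * (cnj u * L g w)"
    unfolding V_def using f g by (simp add: A_mult)
  hence "u * (u * (cnj u * L (\<lambda>z. f z * g z) w)) = u * (u * ((cnj u * L f w) * (cnj u * L g w)))" by simp
  also have "\<dots> = (cnj u * u) * (cnj u * u) * (L f w * L g w)" by (simp only: ac_simps)
  also have "u * (u * (cnj u * L (\<lambda>z. f z * g z) w)) = (cnj u * u) * (u * L (\<lambda>z. f z * g z) w)"
    by (simp only: ac_simps)
  finally show ?thesis by (simp add: uu)
qed

section \<open>The Gleason-Kahane-Zelazko theorem\<close>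

text \<open>
  Consider the polynomial \<open>x \<mapsto> T ((1 - x * f) ^ n) w\<close>. It does not vanish for
  \<open>norm x * N f < 1\<close>, since \<open>1 - x * f\<close> is then bounded away from zero. By \<open>power_sum_bound\<close>, its
  first two coefficients \<open>- n * a\<close> and \<open>n * (n - 1) / 2 * b\<close>, where \<open>a = T f w\<close> and
  \<open>b = T (f\<^sup>2) w\<close>, satisfy \<open>norm (n\<^sup>2 * a\<^sup>2 - n * (n - 1) * b) \<le> n * (N f)\<^sup>2\<close>. Dividing by
  \<open>n\<^sup>2\<close> and letting \<open>n\<close> tend to infinity gives \<open>a\<^sup>2 = b\<close>.
\<close>
lemma GKZ_square:
  assumes T: "T \<in> linear_operators A" and T1: "T (cst 1) w = 1"
    and nv: "\<And>f c. f \<in> A \<Longrightarrow> 0 < c \<Longrightarrow> (\<And>z. z \<in> \<Omega> \<Longrightarrow> c \<le> norm (f z)) \<Longrightarrow> T f w \<noteq> 0"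
    and f: "f \<in> A"
  shows "T (\<lambda>z. f z * f z) w = T f w * T f w"
proof -
  define M where "M = N f"
  define a where "a = T f w" define b where "b = T (\<lambda>z. f z * f z) w"
  have M0: "0 \<le> M" using N_nonneg[OF f] by (simp add: M_def)
  define e where "e = (\<lambda>j z. cst 1 z * f z ^ j)"
  have eA: "e j \<in> A" for j unfolding e_def by (rule A_power[OF f])
  have e: "e 0 = cst 1" "e 1 = f" "e 2 = (\<lambda>z. f z * f z)"
    using f by (auto simp: e_def cst_def A_outside power2_eq_square)
  have main: "n * norm (a * a - b) \<le> M\<^sup>2 + norm b" if n: "2 \<le> n" for n :: nat
  proof -
    define c where "c = (\<lambda>j. of_nat (n choose j) * (-1) ^ j :: complex)"
    define P where "P = (\<Sum>j\<le>n. monom (c j * T (e j) w) j)"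
    have coeff: "coeff P j = (if j \<le> n then c j * T (e j) w else 0)" for j
      unfolding P_def by (simp add: coeff_sum coeff_monom)
    have "norm ((coeff P 1)\<^sup>2 - 2 * coeff P 2) \<le> n * M\<^sup>2"
    proof (rule power_sum_bound)
      show "degree P \<le> n" by (rule degree_le) (simp add: coeff)
      show "coeff P 0 = 1" by (simp add: coeff c_def e T1)
      fix x :: complex assume x: "norm x * M < 1"
      define h where "h = (\<lambda>z. \<Sum>j\<le>n. (c j * x ^ j) * e j z)"
      have h: "h \<in> A" unfolding h_def by (rule A_sum[OF eA])
      have hz: "h z = (1 - x * f z) ^ n" if "z \<in> \<Omega>" for z
      proof -
        have "(1 - x * f z) ^ n = (\<Sum>j\<le>n. of_nat (n choose j) * (- (x * f z)) ^ j * 1 ^ (n - j))"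
          using binomial_ring[of "- (x * f z)" 1 n] by simp
        also have "\<dots> = h z"
          unfolding h_def c_def e_def using that
          by (intro sum.cong refl) (simp add: power_minus[of "x * f z"] power_mult_distrib)
        finally show ?thesis by simp
      qed
      have "(1 - norm x * M) ^ n \<le> norm (h z)" if z: "z \<in> \<Omega>" for z
      proof -
        have "norm (x * f z) \<le> norm x * M"
          using norm_le_N[OF f z] by (simp add: norm_mult M_def mult_left_mono)
        hence "1 - norm x * M \<le> norm (1 - x * f z)"
          using norm_triangle_ineq2[of 1 "x * f z"] by simp
        thus ?thesis using x by (simp add: hz[OF z] norm_power power_mono)
      qed
      hence "T h w \<noteq> 0" using x by (intro nv[OF h, of "(1 - norm x * M) ^ n"]) auto
      moreover have "T h w = poly P x"
        unfolding h_def P_def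
        by (subst lin_sum[OF T]) (simp_all add: eA poly_sum poly_monom mult_ac)
      ultimately show "poly P x \<noteq> 0" by simp
    qed (rule M0)
    also have "(coeff P 1)\<^sup>2 - 2 * coeff P 2 = n * (n * (a * a - b) + b)"
    proof -
      have "even (n * (n - 1))" using n by (cases n) auto
      hence "(n choose 2) * 2 = n * (n - 1)" by (simp add: choose_two)
      from arg_cong[OF this, of "of_nat :: nat \<Rightarrow> complex"]
      have "of_nat (n choose 2) * 2 = (of_nat n * (of_nat n - 1) :: complex)"
        using n by (simp add: of_nat_diff)
      hence "2 * coeff P 2 = of_nat n * (of_nat n - 1) * b"
        using n by (simp add: coeff c_def e b_def mult.assoc[symmetric] mult.commute[of 2])
      moreover have "coeff P 1 = - (of_nat n * a)"
        using n e(2) by (simp add: coeff c_def a_def)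
      ultimately show ?thesis by (simp add: power2_eq_square algebra_simps)
    qed
    finally have "n * norm (n * (a * a - b) + b) \<le> n * M\<^sup>2" by (simp add: norm_mult)
    hence "norm (n * (a * a - b) + b) \<le> M\<^sup>2" using n by simp
    moreover have "norm (n * (a * a - b)) \<le> norm (n * (a * a - b) + b) + norm b"
      by (metis add_diff_cancel_right' norm_triangle_ineq4)
    ultimately show ?thesis by (simp add: norm_mult)
  qed
  have "a * a - b = 0"
  proof (rule ccontr)
    assume nz: "a * a - b \<noteq> 0"
    then obtain n :: nat where n: "M\<^sup>2 + norm b < n * norm (a * a - b)"
      using reals_Archimedean3[of "norm (a * a - b)"] by auto
    also have "\<dots> \<le> (n + 2) * norm (a * a - b)" by (simp add: distrib_right)
    finally show False using main[of "n + 2"] by simp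
  qed
  thus ?thesis by (simp add: a_def b_def)
qed

section \<open>Pointwise limits of isometries\<close>

lemma closure_of_iff:
  "g \<in> norm_topology A N closure_of S \<longleftrightarrow>
     g \<in> A \<and> (\<forall>\<epsilon>>0. \<exists>h\<in>S. h \<in> A \<and> N (\<lambda>z. g z - h z) < \<epsilon>)"
proof -
  interpret M: Metric_space A "norm_dist A N" by (rule Metric_space_H_infinity[OF nonempty])
  show ?thesis
    unfolding norm_topology_def M.metric_closure_of by (auto simp: norm_dist_def)
qed

lemma isometry_bounded:
  assumes L: "L \<in> linear_operators A" and n: "\<And>f. f \<in> A \<Longrightarrow> N (L f) = N f"
  shows "L \<in> bounded_operators A N"
proof -
  interpret M: Metric_space A "norm_dist A N" by (rule Metric_space_H_infinity[OF nonempty])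
  have "norm_dist A N (L f) (L g) = norm_dist A N f g" if "f \<in> A" "g \<in> A" for f g
    using that lin_in[OF L] n[OF A_diff[OF that]] lin_diff[OF L that] by (simp add: norm_dist_def)
  thus ?thesis
    unfolding bounded_operators_def norm_topology_def M.metric_continuous_map[OF M.Metric_space_axioms]
    using L lin_in[OF L] by auto
qed

lemma Iso_bounded: "Iso A N \<subseteq> bounded_operators A N"
  using isometry_bounded Iso_lin Iso_norm by auto

lemma ref_to_lin: "T \<in> ref_to A N S \<Longrightarrow> T \<in> linear_operators A"
  by (simp add: ref_to_def bounded_operators_def)

lemma ref_to_approx:
  assumes "T \<in> ref_to A N S" "f \<in> A" "0 < \<epsilon>"
  obtains L where "L \<in> S" "L f \<in> A" "\<And>z. z \<in> \<Omega> \<Longrightarrow> norm (T f z - L f z) < \<epsilon>"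
proof -
  have "T f \<in> norm_topology A N closure_of {L f |L. L \<in> S}"
    using assms(1,2) by (simp add: ref_to_def)
  then obtain L where L: "T f \<in> A" "L \<in> S" "L f \<in> A" "N (\<lambda>z. T f z - L f z) < \<epsilon>"
    using assms(3) unfolding closure_of_iff by auto
  show ?thesis
  proof (rule that[OF L(2,3)])
    show "norm (T f z - L f z) < \<epsilon>" if "z \<in> \<Omega>" for z
      using norm_le_N[OF A_diff[OF L(1,3)] that] L(4) by (rule le_less_trans)
  qed
qed

lemma subset_ref_to:
  assumes "S \<subseteq> bounded_operators A N" shows "S \<subseteq> ref_to A N S"
proof
  fix L assume L: "L \<in> S"
  hence lin: "L \<in> linear_operators A" using assms by (auto simp: bounded_operators_def)
  have "L f \<in> norm_topology A N closure_of {L f |L. L \<in> S}" if f: "f \<in> A" for f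
    unfolding closure_of_iff
  proof (intro conjI allI impI)
    fix \<epsilon> :: real assume "0 < \<epsilon>"
    moreover have "N (\<lambda>z. L f z - L f z) = 0" unfolding sup_norm_def using nonempty by simp
    ultimately show "\<exists>h\<in>{L f |L. L \<in> S}. h \<in> A \<and> N (\<lambda>z. L f z - h z) < \<epsilon>"
      using L lin_in[OF lin f] by (intro bexI[of _ "L f"]) auto
  qed (rule lin_in[OF lin f])
  thus "L \<in> ref_to A N S" using L assms by (auto simp: ref_to_def)
qed

lemma ref_to_mono: "S \<subseteq> S' \<Longrightarrow> ref_to A N S \<subseteq> ref_to A N S'"
proof
  fix T assume S: "S \<subseteq> S'" and T: "T \<in> ref_to A N S"
  have "T f \<in> norm_topology A N closure_of {L f |L. L \<in> S'}" if "f \<in> A" for f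
  proof (rule subsetD[OF closure_of_mono])
    show "{L f |L. L \<in> S} \<subseteq> {L f |L. L \<in> S'}" using S by blast
    show "T f \<in> norm_topology A N closure_of {L f |L. L \<in> S}" using T that by (simp add: ref_to_def)
  qed
  thus "T \<in> ref_to A N S'" using T by (simp add: ref_to_def)
qed

lemma ref_to_Iso_norm:
  assumes T: "T \<in> ref_to A N (Iso A N)" and f: "f \<in> A"
  shows "N (T f) = N f"
proof (rule antisym)
  note lin = ref_to_lin[OF T]
  show "N (T f) \<le> N f"
  proof (rule field_le_epsilon)
    fix e :: real assume "0 < e"
    then obtain L where L: "L \<in> Iso A N" "L f \<in> A" "\<And>z. z \<in> \<Omega> \<Longrightarrow> norm (T f z - L f z) < e"
      using ref_to_approx[OF T f] by blast
    have "norm (T f z) \<le> N f + e" if z: "z \<in> \<Omega>" for z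
      using L(3)[OF z] norm_le_N[OF L(2) z] Iso_norm[OF L(1) f] norm_triangle_ineq2[of "T f z" "L f z"]
      by linarith
    thus "N (T f) \<le> N f + e" by (rule N_le)
  qed
  show "N f \<le> N (T f)"
  proof (rule field_le_epsilon)
    fix e :: real assume "0 < e"
    then obtain L where L: "L \<in> Iso A N" "L f \<in> A" "\<And>z. z \<in> \<Omega> \<Longrightarrow> norm (T f z - L f z) < e"
      using ref_to_approx[OF T f] by blast
    have "norm (L f z) \<le> N (T f) + e" if z: "z \<in> \<Omega>" for z
      using L(3)[OF z] norm_le_N[OF lin_in[OF lin f] z] norm_triangle_ineq3[of "T f z" "L f z"]
      by linarith
    hence "N (L f) \<le> N (T f) + e" by (rule N_le)
    thus "N f \<le> N (T f) + e" using Iso_norm[OF L(1) f] by simp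
  qed
qed

lemma ref_to_Iso_one:
  assumes T: "T \<in> ref_to A N (Iso A N)"
  obtains u where "norm u = 1" "T (cst 1) = cst u"
proof -
  note lin = ref_to_lin[OF T]
  obtain w where w: "w \<in> \<Omega>" using nonempty by blast
  have "T (cst 1) z = T (cst 1) w" if z: "z \<in> \<Omega>" for z
  proof -
    have "norm (T (cst 1) z - T (cst 1) w) \<le> 0 + e" if "0 < e" for e
    proof -
      have "0 < e / 2" using that by simp
      then obtain L where L: "L \<in> Iso A N" "\<And>z. z \<in> \<Omega> \<Longrightarrow> norm (T (cst 1) z - L (cst 1) z) < e / 2"
        using ref_to_approx[OF T A_cst] by metis
      obtain u where "L (cst 1) = cst u" using Iso_one[OF L(1)] by blast
      thus ?thesis using norm_diff_triangle_less[of "T (cst 1) z" u "e/2" "T (cst 1) w" "e/2"]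
          L(2)[OF z] L(2)[OF w] z w by (simp add: norm_minus_commute less_imp_le)
    qed
    hence "norm (T (cst 1) z - T (cst 1) w) \<le> 0" by (rule field_le_epsilon)
    thus ?thesis by simp
  qed
  hence u: "T (cst 1) = cst (T (cst 1) w)" by (intro A_eqI A_cst lin_in[OF lin]) auto
  have "norm (T (cst 1) w) = 1" using ref_to_Iso_norm[OF T A_cst, of 1] by (subst (asm) u) simp
  thus ?thesis using that u by blast
qed

text \<open>
  Multiplicativity of \<open>L\<close> turns an inverse of \<open>f\<close> into an inverse of \<open>L f\<close> of the same norm, up
  to a unimodular constant.
\<close>
lemma Iso_bounded_below:
  assumes L: "L \<in> Iso A N" and f: "f \<in> A" and c: "0 < c" "\<And>z. z \<in> \<Omega> \<Longrightarrow> c \<le> norm (f z)"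
    and w: "w \<in> \<Omega>"
  shows "c \<le> norm (L f w)"
proof -
  note lin = Iso_lin[OF L]
  define g where "g = (\<lambda>z. inverse (f z))"
  have g: "g \<in> A" "N g \<le> inverse c" unfolding g_def using A_inverse[OF f c] by auto
  obtain u where u: "norm u = 1" "L (cst 1) = cst u" using Iso_one[OF L] by blast
  have "(\<lambda>z. f z * g z) = cst 1"
  proof (rule A_eqI[OF A_mult[OF f g(1)] A_cst])
    fix z assume z: "z \<in> \<Omega>"
    hence "f z \<noteq> 0" using c by fastforce
    thus "f z * g z = cst 1 z" using z by (simp add: g_def)
  qed
  hence "u * u = L f w * L g w" using Iso_multiplicative[OF L u(2) f g(1) w] u(2) w by simp
  hence "1 = norm (L f w) * norm (L g w)" using u(1) by (metis norm_mult mult_1)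
  also have "\<dots> \<le> norm (L f w) * inverse c"
    using norm_le_N[OF lin_in[OF lin g(1)] w] Iso_norm[OF L g(1)] g(2) by (intro mult_left_mono) auto
  finally show ?thesis using c(1) by (simp add: field_simps)
qed

text \<open>
  Unlike multiplicativity, a lower bound involves \<open>T\<close> at one function only and is therefore
  inherited from the approximating isometries.
\<close>
lemma ref_to_Iso_bounded_below:
  assumes T: "T \<in> ref_to A N (Iso A N)" and f: "f \<in> A"
    and c: "0 < c" "\<And>z. z \<in> \<Omega> \<Longrightarrow> c \<le> norm (f z)" and w: "w \<in> \<Omega>"
  shows "c \<le> norm (T f w)"
proof (rule field_le_epsilon)
  fix e :: real assume "0 < e"
  then obtain L where L: "L \<in> Iso A N" "L f \<in> A" "\<And>z. z \<in> \<Omega> \<Longrightarrow> norm (T f z - L f z) < e"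
    using ref_to_approx[OF T f] by blast
  show "c \<le> norm (T f w) + e"
    using Iso_bounded_below[OF L(1) f c w] L(3)[OF w] norm_triangle_ineq3[of "T f w" "L f w"] by linarith
qed

definition unital_hom :: "((complex \<Rightarrow> complex) \<Rightarrow> complex \<Rightarrow> complex) \<Rightarrow> bool" where
  "unital_hom V \<longleftrightarrow> V \<in> linear_operators A \<and> V (cst 1) = cst 1 \<and>
     (\<forall>f\<in>A. \<forall>g\<in>A. V (\<lambda>z. f z * g z) = (\<lambda>z. V f z * V g z))"

lemma unital_Iso_hom:
  assumes V: "V \<in> Iso A N" and V1: "V (cst 1) = cst 1"
  shows "unital_hom V"
  unfolding unital_hom_def
proof (intro conjI ballI Iso_lin[OF V] V1)
  fix f g assume f: "f \<in> A" and g: "g \<in> A"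
  show "V (\<lambda>z. f z * g z) = (\<lambda>z. V f z * V g z)"
    using Iso_multiplicative[OF V V1 f g] lin_in[OF Iso_lin[OF V]] f g
    by (intro A_eqI A_mult) (auto intro: A_mult)
qed

lemma ref_to_Iso_hom:
  assumes T: "T \<in> ref_to A N (Iso A N)" and u: "norm u = 1" "T (cst 1) = cst u"
  shows "unital_hom (restrict (\<lambda>f z. cnj u * T f z) A)" (is "unital_hom ?V")
  unfolding unital_hom_def
proof (intro conjI ballI)
  note lin = ref_to_lin[OF T]
  have uu: "cnj u * u = 1" using u(1) complex_norm_square[of u] by (simp add: mult.commute)
  show V: "?V \<in> linear_operators A" by (rule scaled_lin[OF lin])
  show V1: "?V (cst 1) = cst 1" using u(2) uu by (simp add: A_cst) (auto simp: cst_def)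
  have sq: "?V (\<lambda>z. f z * f z) w = ?V f w * ?V f w" if f: "f \<in> A" and w: "w \<in> \<Omega>" for f w
  proof (rule GKZ_square[OF V _ _ f])
    show "?V (cst 1) w = 1" using w by (simp only: V1) simp
    fix g c assume g: "g \<in> A" "0 < c" "\<And>z. z \<in> \<Omega> \<Longrightarrow> c \<le> norm (g z)"
    have "norm (?V g w) = norm (T g w)" using g(1) u(1) by (simp add: norm_mult)
    thus "?V g w \<noteq> 0" using ref_to_Iso_bounded_below[OF T g w] g(2) by (metis norm_zero not_less)
  qed
  fix f g assume f: "f \<in> A" and g: "g \<in> A"
  show "?V (\<lambda>z. f z * g z) = (\<lambda>z. ?V f z * ?V g z)"
  proof (rule A_eqI)
    show "?V (\<lambda>z. f z * g z) \<in> A" by (rule lin_in[OF V A_mult[OF f g]])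
    show "(\<lambda>z. ?V f z * ?V g z) \<in> A" by (rule A_mult[OF lin_in[OF V f] lin_in[OF V g]])
    show "?V (\<lambda>z. f z * g z) w = ?V f w * ?V g w" if "w \<in> \<Omega>" for w
      by (rule mult_from_squares[OF V f g that]) (rule sq[OF _ that])
  qed
qed

lemma bij_betw_rotate:
  fixes c :: complex
  assumes "bij_betw \<phi> \<Omega> (ball 0 1)" "norm c = 1"
  shows "bij_betw (\<lambda>z. c * \<phi> z) \<Omega> (ball 0 1)"
proof -
  have c: "c \<noteq> 0" using assms(2) by auto
  have "bij_betw ((*) c) (ball 0 1) (ball 0 1)"
    by (rule bij_betwI[where g = "(*) (inverse c)"])
       (use c assms(2) in \<open>auto simp: norm_mult norm_inverse norm_divide\<close>)
  from bij_betw_trans[OF assms(1) this] show ?thesis by (simp add: o_def)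
qed

section \<open>Uniform limits of biholomorphic maps onto the disc\<close>

lemma self_map_strict:
  assumes "\<phi> holomorphic_on \<Omega>" "\<And>z. z \<in> \<Omega> \<Longrightarrow> norm (\<phi> z) \<le> 1" "\<not> \<phi> constant_on \<Omega>" "w \<in> \<Omega>"
  shows "norm (\<phi> w) < 1"
proof (rule ccontr)
  assume "\<not> norm (\<phi> w) < 1"
  hence "norm (\<phi> z) \<le> norm (\<phi> w)" if "z \<in> \<Omega>" for z using assms(2)[OF that] by simp
  hence "\<phi> constant_on \<Omega>"
    by (intro maximum_modulus_principle[OF assms(1) open_domain connected_domain open_domain order_refl assms(4)])
  thus False using assms(3) by simp
qed

text \<open>
  Injectivity is Hurwitz's theorem, once the limit is known to be nonconstant. For surjectivity
  let \<open>j\<close> be the inverse of a bijection within distance \<open>e\<close> of \<open>\<phi>\<close>. Then \<open>\<phi> \<circ> j\<close> moves points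
  by less than \<open>e\<close>, so \<open>z \<mapsto> z - \<phi> (j z) + b\<close> maps the closed disc of radius \<open>norm b + e\<close>
  into itself, and a Brouwer fixed point of it is a solution of \<open>\<phi> (j z) = b\<close>.
\<close>
lemma limit_of_bijections:
  assumes hol: "\<phi> holomorphic_on \<Omega>"
    and approx: "\<And>e. 0 < e \<Longrightarrow> \<exists>\<psi>. \<psi> holomorphic_on \<Omega> \<and> bij_betw \<psi> \<Omega> (ball 0 1) \<and>
                   (\<forall>z\<in>\<Omega>. norm (\<phi> z - \<psi> z) < e)"
  shows "bij_betw \<phi> \<Omega> (ball 0 1)"
proof -
  have onto: "ball 0 1 \<subseteq> \<phi> ` \<Omega>"
  proof
    fix b :: complex assume "b \<in> ball 0 1"
    define e where "e = (1 - norm b) / 2"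
    have e: "0 < e" "norm b + e < 1" using \<open>b \<in> ball 0 1\<close> by (auto simp: e_def field_simps)
    obtain \<psi> where \<psi>: "\<psi> holomorphic_on \<Omega>" "bij_betw \<psi> \<Omega> (ball 0 1)" "\<And>z. z \<in> \<Omega> \<Longrightarrow> norm (\<phi> z - \<psi> z) < e"
      using approx[OF e(1)] by blast
    obtain j where j: "j holomorphic_on \<psi> ` \<Omega>" "\<And>z. z \<in> \<Omega> \<Longrightarrow> j (\<psi> z) = z"
      using holomorphic_has_inverse[OF \<psi>(1) open_domain] \<psi>(2) by (metis bij_betw_def)
    have im: "\<psi> ` \<Omega> = ball 0 1" using \<psi>(2) by (simp add: bij_betw_def)
    have j': "j z \<in> \<Omega>" "\<psi> (j z) = z" if "z \<in> ball 0 1" for z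
      using that j(2) unfolding im[symmetric] by auto
    define k where "k = (\<lambda>z. z - \<phi> (j z) + b)"
    have sub: "cball 0 (norm b + e) \<subseteq> ball (0::complex) 1" using e by auto
    have "\<phi> \<circ> j holomorphic_on ball 0 1"
      using j(1) hol j'(1) unfolding im by (intro holomorphic_on_compose_gen[of _ _ _ \<Omega>]) auto
    hence "k holomorphic_on ball 0 1" unfolding k_def o_def by (intro holomorphic_intros)
    hence "continuous_on (cball 0 (norm b + e)) k"
      using sub holomorphic_on_imp_continuous_on continuous_on_subset by blast
    moreover have "k \<in> cball 0 (norm b + e) \<rightarrow> cball 0 (norm b + e)"
    proof
      fix z :: complex assume "z \<in> cball 0 (norm b + e)"
      hence z: "z \<in> ball 0 1" using sub by blast
      have "norm (\<phi> (j z) - z) < e" using \<psi>(3)[OF j'(1)[OF z]] j'(2)[OF z] by simp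
      hence "norm (k z) \<le> e + norm b"
        using norm_triangle_ineq[of "z - \<phi> (j z)" b] by (simp add: k_def norm_minus_commute)
      thus "k z \<in> cball 0 (norm b + e)" by simp
    qed
    ultimately obtain z where z: "z \<in> cball 0 (norm b + e)" "k z = z"
      using brouwer_ball[of "norm b + e" 0 k] e by (metis add_nonneg_pos norm_ge_zero)
    hence "\<phi> (j z) = b" by (simp add: k_def)
    thus "b \<in> \<phi> ` \<Omega>" using j'(1) z(1) sub by blast
  qed
  have nonconst: "\<not> \<phi> constant_on \<Omega>"
  proof
    assume "\<phi> constant_on \<Omega>"
    then obtain c where "\<phi> ` \<Omega> \<subseteq> {c}" unfolding constant_on_def by blast
    hence "ball 0 1 \<subseteq> {c}" using onto by blast
    moreover have "(0::complex) \<in> ball 0 1" "(1/2::complex) \<in> ball 0 1" by (auto simp: norm_divide)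
    ultimately have "0 = c" "1/2 = c" by blast+
    thus False by simp
  qed
  have le1: "norm (\<phi> z) \<le> 1" if z: "z \<in> \<Omega>" for z
  proof (rule field_le_epsilon)
    fix e :: real assume "0 < e"
    then obtain \<psi> where \<psi>: "bij_betw \<psi> \<Omega> (ball 0 1)" "norm (\<phi> z - \<psi> z) < e"
      using approx z by blast
    hence "norm (\<psi> z) < 1" using z by (auto simp: bij_betw_def)
    thus "norm (\<phi> z) \<le> 1 + e" using \<psi>(2) norm_triangle_ineq2[of "\<phi> z" "\<psi> z"] by linarith
  qed
  have "\<exists>\<psi>. \<forall>n::nat. \<psi> n holomorphic_on \<Omega> \<and> bij_betw (\<psi> n) \<Omega> (ball 0 1) \<and>
      (\<forall>z\<in>\<Omega>. norm (\<phi> z - \<psi> n z) < inverse (Suc n))"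
    using approx[of "inverse (real (Suc _))"] by (intro choice allI) auto
  then obtain \<psi> where \<psi>: "\<And>n::nat. \<psi> n holomorphic_on \<Omega>" "\<And>n. bij_betw (\<psi> n) \<Omega> (ball 0 1)"
      "\<And>n z. z \<in> \<Omega> \<Longrightarrow> norm (\<phi> z - \<psi> n z) < inverse (Suc n)" by blast
  have "inj_on \<phi> \<Omega>"
  proof (rule Hurwitz_injective[OF open_domain connected_domain \<psi>(1) hol _ nonconst])
    show "inj_on (\<psi> n) \<Omega>" for n using \<psi>(2) by (simp add: bij_betw_def)
    fix K assume K: "compact K" "K \<subseteq> \<Omega>"
    show "uniform_limit K \<psi> \<phi> sequentially"
    proof (rule uniform_limitI)
      fix e :: real assume "0 < e"
      then obtain m where m: "inverse (Suc m) < e" using reals_Archimedean by blast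
      show "\<forall>\<^sub>F n in sequentially. \<forall>z\<in>K. dist (\<psi> n z) (\<phi> z) < e"
      proof (rule eventually_sequentiallyI[of m], intro ballI)
        fix n z assume "m \<le> n" "z \<in> K"
        have "norm (\<phi> z - \<psi> n z) < inverse (Suc n)" using \<psi>(3) K \<open>z \<in> K\<close> by blast
        also have "\<dots> \<le> inverse (Suc m)" using \<open>m \<le> n\<close> by (intro le_imp_inverse_le) auto
        finally show "dist (\<psi> n z) (\<phi> z) < e" using m by (simp add: dist_norm norm_minus_commute)
      qed
    qed
  qed
  moreover have "\<phi> ` \<Omega> = ball 0 1"
    using onto self_map_strict[OF hol le1 nonconst] by auto
  ultimately show ?thesis by (simp add: bij_betw_def)
qed

end

section \<open>Homomorphisms as composition operators\<close>

text \<open>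
  The Riemann map \<open>r\<close> is extended by zero so that it is an element of the algebra.
\<close>
locale riemann_mapped_domain = planar_domain +
  fixes r s :: "complex \<Rightarrow> complex"
  assumes r_hol: "r holomorphic_on \<Omega>" 
    and r_zero: "\<And>z. z \<notin> \<Omega> \<Longrightarrow> r z = 0"
    and r_disc: "\<And>z. z \<in> \<Omega> \<Longrightarrow> norm (r z) < 1" and sr: "\<And>z. z \<in> \<Omega> \<Longrightarrow> s (r z) = z"
    and s_in: "\<And>z. norm z < 1 \<Longrightarrow> s z \<in> \<Omega>" and rs: "\<And>z. norm z < 1 \<Longrightarrow> r (s z) = z"
begin

lemma r_in_A: "r \<in> A"
  using r_hol r_zero r_disc by (intro A_I[where B = 1]) (auto intro: less_imp_le)

lemma N_r: "N r \<le> 1"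
  using r_disc by (intro N_le) (auto intro: less_imp_le)

text \<open>
  The quotient is holomorphic because \<open>r\<close> is injective, so that \<open>r - r a\<close> has a simple zero at
  \<open>a\<close> and no other zero. It is bounded near \<open>a\<close> by compactness, and away from \<open>a\<close> because \<open>r\<close> is open and
  injective, which keeps \<open>r - r a\<close> away from zero there.
\<close>
lemma factor_at:
  assumes f: "f \<in> A" and a: "a \<in> \<Omega>"
  obtains h where "h \<in> A" "\<And>z. z \<in> \<Omega> \<Longrightarrow> f z - f a = (r z - r a) * h z"
proof -
  have inj: "inj_on r \<Omega>" using sr by (rule inj_on_inverseI)
  define F where "F = (\<lambda>z. if z = a then deriv f a else (f z - f a) / (z - a))"
  define G where "G = (\<lambda>z. if z = a then deriv r a else (r z - r a) / (z - a))"
  have F: "F holomorphic_on \<Omega>" and G: "G holomorphic_on \<Omega>"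
    unfolding F_def G_def by (rule pole_lemma_open[OF A_hol[OF f] open_domain], rule pole_lemma_open[OF r_hol open_domain])
  have da: "deriv r a \<noteq> 0"
    by (rule holomorphic_injective_imp_regular[OF r_hol open_domain inj a])
  have ra: "r z \<noteq> r a" if "z \<in> \<Omega>" "z \<noteq> a" for z using inj that a by (auto dest: inj_onD)
  have Gnz: "G z \<noteq> 0" if "z \<in> \<Omega>" for z using ra da that by (auto simp: G_def)
  define h where "h = (\<lambda>z. if z \<in> \<Omega> then F z / G z else 0)"
  have h_hol: "h holomorphic_on \<Omega>"
  proof (rule holomorphic_transform)
    show "(\<lambda>z. F z / G z) holomorphic_on \<Omega>" by (rule holomorphic_on_divide[OF F G Gnz])
    show "F z / G z = h z" if "z \<in> \<Omega>" for z using that by (simp add: h_def)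
  qed
  have eq: "f z - f a = (r z - r a) * h z" if z: "z \<in> \<Omega>" for z
    using ra[OF z] z by (cases "z = a") (auto simp: h_def F_def G_def)
  obtain e where e: "0 < e" "cball a e \<subseteq> \<Omega>" using open_domain a open_contains_cball by blast
  have "open (r ` ball a e)"
  proof (rule open_mapping_thm3)
    have sub: "ball a e \<subseteq> \<Omega>" using e(2) by auto
    show "r holomorphic_on ball a e" by (rule holomorphic_on_subset[OF r_hol sub])
    show "inj_on r (ball a e)" by (rule inj_on_subset[OF inj sub])
  qed simp
  then obtain d where d: "0 < d" "ball (r a) d \<subseteq> r ` ball a e"
    using e(1) by (meson centre_in_ball imageI openE)
  have "bounded (h ` cball a e)"
    using e(2) by (intro compact_imp_bounded compact_continuous_image compact_cball
        holomorphic_on_imp_continuous_on holomorphic_on_subset[OF h_hol])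
  then obtain B where B: "\<And>z. z \<in> cball a e \<Longrightarrow> norm (h z) \<le> B" unfolding bounded_iff by (metis imageI)
  have far: "norm (h z) \<le> 2 * N f / d" if z: "z \<in> \<Omega>" "z \<notin> cball a e" for z
  proof -
    have "r z \<notin> ball (r a) d"
    proof
      assume "r z \<in> ball (r a) d"
      then obtain y where "y \<in> ball a e" "r y = r z" using d(2) by (metis imageE subsetD)
      moreover have "y \<in> \<Omega>" using \<open>y \<in> ball a e\<close> e(2) by auto
      ultimately have "y = z" using inj z(1) by (auto dest: inj_onD)
      thus False using \<open>y \<in> ball a e\<close> z(2) by auto
    qed
    hence "d \<le> norm (r z - r a)" by (simp add: dist_norm norm_minus_commute)
    hence "d * norm (h z) \<le> norm (r z - r a) * norm (h z)" by (intro mult_right_mono) auto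
    also have "\<dots> = norm (f z - f a)" using eq[OF z(1)] by (simp add: norm_mult)
    also have "\<dots> \<le> 2 * N f"
      using norm_le_N[OF f z(1)] norm_le_N[OF f a] norm_triangle_ineq4[of "f z" "f a"] by simp
    finally show ?thesis using d(1) by (simp add: field_simps)
  qed
  have "h \<in> A"
  proof (rule A_I[OF h_hol])
    show "norm (h z) \<le> max B (2 * N f / d)" if "z \<in> \<Omega>" for z
      using B[of z] far[OF that] by (cases "z \<in> cball a e") (auto simp: le_max_iff_disj)
  qed (simp add: h_def)
  thus ?thesis using that eq by blast
qed

text \<open>
  With \<open>a = s (V r w)\<close>, apply \<open>V\<close> to \<open>f = f a + (r - r a) * h\<close> and evaluate at \<open>w\<close>, where
  \<open>V r - r a\<close> vanishes.
\<close>
lemma hom_is_composition: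
  assumes V: "unital_hom V" and f: "f \<in> A" and w: "w \<in> \<Omega>" and lt: "norm (V r w) < 1"
  shows "V f w = f (s (V r w))"
proof -
  have lin: "V \<in> linear_operators A" and V1: "V (cst 1) = cst 1"
    and mult: "\<And>f g. f \<in> A \<Longrightarrow> g \<in> A \<Longrightarrow> V (\<lambda>z. f z * g z) = (\<lambda>z. V f z * V g z)"
    using V by (auto simp: unital_hom_def)
  define a where "a = s (V r w)"
  have a: "a \<in> \<Omega>" "r a = V r w" using s_in[OF lt] rs[OF lt] by (auto simp: a_def)
  obtain h where h: "h \<in> A" "\<And>z. z \<in> \<Omega> \<Longrightarrow> f z - f a = (r z - r a) * h z"
    using factor_at[OF f a(1)] by blast
  have ra: "(\<lambda>z. r z - cst (r a) z) \<in> A" by (intro A_diff r_in_A A_cst)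
  have eq: "f = (\<lambda>z. cst (f a) z + (r z - cst (r a) z) * h z)"
    using h(2) by (intro A_eqI f A_add A_cst A_mult ra h) (auto simp: algebra_simps)
  have "V f = V (\<lambda>z. cst (f a) z + (r z - cst (r a) z) * h z)"
    by (rule arg_cong[OF eq])
  also have "\<dots> = (\<lambda>z. V (cst (f a)) z + (V r z - V (cst (r a)) z) * V h z)"
    by (simp only: lin_add[OF lin A_cst A_mult[OF ra h(1)]] mult[OF ra h(1)]
      lin_diff[OF lin r_in_A A_cst])
  finally have "V f w = f a + (V r w - r a) * V h w" 
    using w by (simp add: lin_cst[OF lin, of "f a"] lin_cst[OF lin, of "r a"] V1)
  thus ?thesis using a by (simp add: a_def)
qed

lemma r_not_const: "\<not> r constant_on \<Omega>"
proof
  assume "r constant_on \<Omega>"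
  then obtain c where "\<And>z. z \<in> \<Omega> \<Longrightarrow> r z = c" unfolding constant_on_def by blast
  hence "r (s 0) = c" "r (s (1/2)) = c" using s_in by (auto simp: norm_divide)
  thus False using rs[of 0] rs[of "1/2"] by (auto simp: norm_divide)
qed

lemma unital_Iso_disc:
  assumes V: "V \<in> Iso A N" and V1: "V (cst 1) = cst 1" and w: "w \<in> \<Omega>"
  shows "norm (V r w) < 1"
proof (rule self_map_strict[OF A_hol[OF lin_in[OF Iso_lin[OF V] r_in_A]] _ _ w])
  note Vr = lin_in[OF Iso_lin[OF V] r_in_A]
  show "norm (V r z) \<le> 1" if "z \<in> \<Omega>" for z
    using norm_le_N[OF Vr that] Iso_norm[OF V r_in_A] N_r by simp
  show "\<not> V r constant_on \<Omega>"
  proof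
    assume "V r constant_on \<Omega>"
    then obtain c where "\<And>z. z \<in> \<Omega> \<Longrightarrow> V r z = c" unfolding constant_on_def by blast
    hence "V r = cst c" by (intro A_eqI A_cst Vr) auto
    also have "\<dots> = V (cst c)" using lin_cst[OF Iso_lin[OF V], of c] V1 by (simp add: cst_eq_scale[of c])
    finally have "r = cst c"
      using isometry_inj[OF Iso_lin[OF V] Iso_norm[OF V]] r_in_A A_cst by (auto dest: inj_onD)
    thus False using r_not_const by (auto simp: constant_on_def)
  qed
qed

text \<open>
  After division by \<open>L 1\<close>, the operator \<open>V\<close> and its inverse \<open>W\<close> are composition with
  \<open>s \<circ> V r\<close> and \<open>s \<circ> W r\<close>. These self-maps of \<open>\<Omega>\<close> are inverse to each other.
\<close>
lemma Iso_r_bij: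
  assumes L: "L \<in> Iso A N"
  shows "bij_betw (L r) \<Omega> (ball 0 1)"
proof -
  obtain u where u: "norm u = 1" "L (cst 1) = cst u" using Iso_one[OF L] by blast
  have uu: "cnj u * u = 1" using u(1) complex_norm_square[of u] by (simp add: mult.commute)
  define V where "V = restrict (\<lambda>f z. cnj u * L f z) A"
  have V: "V \<in> Iso A N" unfolding V_def using L u by (intro Iso_scaled) auto
  have V1: "V (cst 1) = cst 1" unfolding V_def using uu u by (simp add: A_cst) (auto simp: cst_def)
  obtain W where W: "W \<in> Iso A N" and WV: "\<And>f. f \<in> A \<Longrightarrow> W (V f) = f"
    and VW: "\<And>f. f \<in> A \<Longrightarrow> V (W f) = f" using Iso_inverse[OF V] by metis
  have W1: "W (cst 1) = cst 1" using WV[OF A_cst, of 1] V1 by simp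
  have Vr: "V r \<in> A" and Wr: "W r \<in> A" using lin_in[OF Iso_lin] V W r_in_A by auto
  note lV = unital_Iso_disc[OF V V1] and lW = unital_Iso_disc[OF W W1]
  have "W r (s (V r w)) = r w" if "w \<in> \<Omega>" for w
    using hom_is_composition[OF unital_Iso_hom[OF V V1] Wr that lV[OF that]] VW[OF r_in_A] by simp
  hence inj: "inj_on (V r) \<Omega>" by (intro inj_on_inverseI[where g = "\<lambda>b. s (W r (s b))"]) (simp add: sr)
  have *: "V r (s (W r w)) = r w" if "w \<in> \<Omega>" for w
    using hom_is_composition[OF unital_Iso_hom[OF W W1] Vr that lW[OF that]] WV[OF r_in_A] by simp
  have "b \<in> V r ` \<Omega>" if "b \<in> ball 0 1" for b
  proof -
    have sb: "s b \<in> \<Omega>" "r (s b) = b" using s_in[of b] rs[of b] that by auto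
    have "V r (s (W r (s b))) = b" using *[OF sb(1)] sb(2) by simp
    thus ?thesis using s_in[OF lW[OF sb(1)]] by (metis imageI)
  qed
  hence "V r ` \<Omega> = ball 0 1" using lV by auto
  hence "bij_betw (V r) \<Omega> (ball 0 1)" using inj by (simp add: bij_betw_def)
  from bij_betw_rotate[OF this u(1)] have "bij_betw (\<lambda>z. u * V r z) \<Omega> (ball 0 1)" .
  moreover have "(\<lambda>z. u * V r z) = L r"
    using uu by (simp add: V_def r_in_A mult.assoc[symmetric] mult.commute[of u])
  ultimately show ?thesis by simp
qed

text \<open>
  Here \<open>V r\<close> maps \<open>\<Omega>\<close> biholomorphically onto the disc, with inverse \<open>j\<close>, so composition with
  \<open>s \<circ> V r\<close> is inverted by composition with \<open>j \<circ> r\<close>.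
\<close>
lemma ref_to_Iso_surj:
  assumes T: "T \<in> ref_to A N (Iso A N)" and g: "g \<in> A"
  shows "g \<in> T ` A"
proof -
  note lin = ref_to_lin[OF T]
  obtain u where u: "norm u = 1" "T (cst 1) = cst u" using ref_to_Iso_one[OF T] by blast
  have uu: "u * cnj u = 1" using u(1) complex_norm_square[of u] by simp
  define V where "V = restrict (\<lambda>f z. cnj u * T f z) A"
  have V: "unital_hom V" unfolding V_def by (rule ref_to_Iso_hom[OF T u])
  have Tr: "T r \<in> A" by (rule lin_in[OF lin r_in_A])
  have "bij_betw (T r) \<Omega> (ball 0 1)"
  proof (rule limit_of_bijections[OF A_hol[OF Tr]])
    fix e :: real assume "0 < e"
    then obtain L where "L \<in> Iso A N" "L r \<in> A" "\<And>z. z \<in> \<Omega> \<Longrightarrow> norm (T r z - L r z) < e"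
      using ref_to_approx[OF T r_in_A] by blast
    thus "\<exists>\<psi>. \<psi> holomorphic_on \<Omega> \<and> bij_betw \<psi> \<Omega> (ball 0 1) \<and> (\<forall>z\<in>\<Omega>. norm (T r z - \<psi> z) < e)"
      using Iso_r_bij A_hol by blast
  qed
  from bij_betw_rotate[OF this, of "cnj u"] have bij: "bij_betw (V r) \<Omega> (ball 0 1)"
    using u(1) by (simp add: V_def r_in_A)
  have Vlin: "V \<in> linear_operators A" using V by (simp add: unital_hom_def)
  have Vr: "V r \<in> A" by (rule lin_in[OF Vlin r_in_A])
  have im: "V r ` \<Omega> = ball 0 1" using bij by (simp add: bij_betw_def)
  obtain j where j: "j holomorphic_on ball 0 1" "\<And>z. z \<in> \<Omega> \<Longrightarrow> j (V r z) = z"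
    using holomorphic_has_inverse[OF A_hol[OF Vr] open_domain] bij im by (metis bij_betw_def)
  have j_in: "j z \<in> \<Omega>" if "norm z < 1" for z
    using that j(2) im by (metis imageE mem_ball_0)
  define f where "f = (\<lambda>z. if z \<in> \<Omega> then cnj u * g (j (r z)) else 0)"
  have "(\<lambda>z. cnj u * (g \<circ> (j \<circ> r)) z) holomorphic_on \<Omega>"
    using r_disc j_in A_hol[OF g]
    by (intro holomorphic_intros holomorphic_on_compose_gen[of _ _ _ \<Omega>] holomorphic_on_compose_gen[OF r_hol j(1)]) auto
  hence "f holomorphic_on \<Omega>" by (rule holomorphic_transform) (simp add: f_def)
  hence f: "f \<in> A"
    by (rule A_I[where B = "N g"]) (use u(1) norm_le_N[OF g] j_in r_disc in \<open>auto simp: f_def norm_mult\<close>)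
  have "T f = g"
  proof (rule A_eqI[OF lin_in[OF lin f] g])
    fix w assume w: "w \<in> \<Omega>"
    have lt: "norm (V r w) < 1" using im w by auto
    have "V f w = f (s (V r w))" by (rule hom_is_composition[OF V f w lt])
    also have "\<dots> = cnj u * g w" using s_in[OF lt] rs[OF lt] j(2)[OF w] by (simp add: f_def)
    finally have "u * (cnj u * T f w) = u * (cnj u * g w)" by (simp add: V_def f)
    thus "T f w = g w" using uu by (simp add: mult.assoc[symmetric])
  qed
  thus ?thesis using f by blast
qed

end

section \<open>Topological reflexivity\<close>

context planar_domain
begin

lemma ref_to_Iso_surj_plane:
  assumes T: "T \<in> ref_to A N (Iso A N)" and g: "g \<in> A" and UNIV: "\<Omega> = UNIV"
  shows "g \<in> T ` A"
proof -
  obtain u where u: "norm u = 1" "T (cst 1) = cst u" using ref_to_Iso_one[OF T] by blast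
  have "g constant_on UNIV"
    using g UNIV by (intro Liouville_theorem) (auto simp: H_infinity_def)
  then obtain c where c: "\<And>z. g z = c" by (auto simp: constant_on_def)
  have "g = cst c" by (intro A_eqI g A_cst) (simp only: c cst_apply)
  also have "\<dots> = T (cst (c / u))"
  proof -
    have "u \<noteq> 0" using u(1) by auto
    thus ?thesis
      unfolding lin_cst[OF ref_to_lin[OF T], of "c / u"] u(2) by (auto simp: cst_def)
  qed
  finally show ?thesis using A_cst by blast
qed

lemma ref_to_Iso_eq:
  assumes "simply_connected \<Omega>"
  shows "ref_to A N (Iso A N) = Iso A N"
proof
  show "Iso A N \<subseteq> ref_to A N (Iso A N)"
    by (rule subset_ref_to[OF Iso_bounded])
  show "ref_to A N (Iso A N) \<subseteq> Iso A N"
  proof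
    fix T assume T: "T \<in> ref_to A N (Iso A N)"
    have "g \<in> T ` A" if g: "g \<in> A" for g
    proof (cases "\<Omega> = UNIV")
      case True
      thus ?thesis by (rule ref_to_Iso_surj_plane[OF T g])
    next
      case False
      then obtain r s where rs: "r holomorphic_on \<Omega>" "\<And>z. z \<in> \<Omega> \<Longrightarrow> r z \<in> ball 0 1 \<and> s (r z) = z"
        "\<And>z. z \<in> ball 0 1 \<Longrightarrow> s z \<in> \<Omega> \<and> r (s z) = z"
        using Riemann_mapping_theorem[of \<Omega>] open_domain assms nonempty by blast
      have "(\<lambda>z. if z \<in> \<Omega> then r z else 0) holomorphic_on \<Omega>"
        using rs(1) by (rule holomorphic_transform) simp
      then interpret riemann_mapped_domain \<Omega> "\<lambda>z. if z \<in> \<Omega> then r z else 0" s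
        using rs(2,3) by unfold_locales auto
      show ?thesis by (rule ref_to_Iso_surj[OF T g])
    qed
    hence "T ` A = A" using lin_in[OF ref_to_lin[OF T]] by blast
    thus "T \<in> Iso A N" using ref_to_lin[OF T] ref_to_Iso_norm[OF T] by (auto simp: Iso_def)
  qed
qed

text \<open>
  An automorphism preserves invertibility of \<open>c - f\<close> in both directions. This function is
  invertible for \<open>norm c > N f\<close>, while no function with a zero is invertible, so \<open>N f\<close> is
  determined by the algebra structure.
\<close>
lemma Aut_eq: "Aut A N = {L \<in> Iso A N. L (cst 1) = cst 1}"
proof (intro set_eqI iffI)
  fix L assume L: "L \<in> {L \<in> Iso A N. L (cst 1) = cst 1}"
  hence "unital_hom L" using unital_Iso_hom by blast
  moreover have "bij_betw L A A"
    using L isometry_inj[OF Iso_lin Iso_norm] Iso_surj by (auto simp: bij_betw_def)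
  moreover have "L \<in> bounded_operators A N" using L Iso_bounded by blast
  ultimately show "L \<in> Aut A N" by (simp add: Aut_def unital_hom_def)
next
  fix L assume L: "L \<in> Aut A N"
  have lin: "L \<in> linear_operators A" and bij: "bij_betw L A A"
    and mult: "\<And>f g. f \<in> A \<Longrightarrow> g \<in> A \<Longrightarrow> L (\<lambda>z. f z * g z) = (\<lambda>z. L f z * L g z)"
    using L by (auto simp: Aut_def bounded_operators_def)
  have surj: "\<exists>f\<in>A. L f = g" if "g \<in> A" for g using bij that by (metis bij_betw_def imageE)
  have inj: "f = g" if "f \<in> A" "g \<in> A" "L f = L g" for f g
    using bij that by (auto simp: bij_betw_def dest: inj_onD)
  have one: "L (cst 1) = cst 1"
  proof -
    obtain f where f: "f \<in> A" "L f = cst 1" using surj A_cst by blast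
    have "cst 1 = L (\<lambda>z. cst 1 z * f z)" using cst_mult[OF f(1), of 1] f(2) by simp
    also have "\<dots> = (\<lambda>z. cst 1 z * L (cst 1) z)" using mult[OF A_cst f(1), of 1] f(2) by (simp add: mult.commute)
    also have "\<dots> = L (cst 1)" using cst_mult[OF lin_in[OF lin A_cst], of 1 1] by simp
    finally show ?thesis by simp
  qed
  have resolvent: "\<exists>h\<in>A. \<forall>z\<in>\<Omega>. (c - f z) * h z = 1" if f: "f \<in> A" and c: "N f < norm c" for f c
  proof -
    have fc: "(\<lambda>z. cst c z - f z) \<in> A" by (intro A_diff A_cst f)
    have lb: "norm c - N f \<le> norm (cst c z - f z)" if "z \<in> \<Omega>" for z
      using norm_le_N[OF f that] norm_triangle_ineq2[of c "f z"] that by simp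
    have inA: "(\<lambda>z. inverse (cst c z - f z)) \<in> A" by (rule A_inverse[OF fc _ lb]) (use c in auto)
    have "(c - f z) * inverse (cst c z - f z) = 1" if "z \<in> \<Omega>" for z
    proof -
      have "c - f z \<noteq> 0" using lb[OF that] c that by (metis cst_apply norm_zero diff_gt_0_iff_gt not_less)
      thus ?thesis using that by simp
    qed
    thus ?thesis using inA by (intro bexI ballI)
  qed
  have prod: "L (\<lambda>z. (cst c z - f z) * h z) w = (c - L f w) * L h w" if "f \<in> A" "h \<in> A" "w \<in> \<Omega>" for c f h w
    unfolding mult[OF A_diff[OF A_cst that(1)] that(2)] lin_diff[OF lin A_cst that(1)]
      lin_cst[OF lin, of c] one
    using that(3) by simp
  have "N (L f) = N f" if f: "f \<in> A" for f
  proof (rule antisym)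
    show "N (L f) \<le> N f"
    proof (rule N_le, rule ccontr)
      fix w assume w: "w \<in> \<Omega>" and "\<not> norm (L f w) \<le> N f"
      then obtain h where h: "h \<in> A" "\<And>z. z \<in> \<Omega> \<Longrightarrow> (L f w - f z) * h z = 1"
        using resolvent[OF f, of "L f w"] by auto
      have "(\<lambda>z. (cst (L f w) z - f z) * h z) = cst 1"
        using h(2) by (intro A_eqI A_mult A_diff A_cst f h) auto
      from arg_cong[OF this, of L] have "L (\<lambda>z. (cst (L f w) z - f z) * h z) w = 1"
        using w by (simp only: one cst_apply)
      thus False unfolding prod[OF f h(1) w] by simp
    qed
    show "N f \<le> N (L f)"
    proof (rule N_le, rule ccontr)
      fix w assume w: "w \<in> \<Omega>" and "\<not> norm (f w) \<le> N (L f)"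
      then obtain k where k: "k \<in> A" "\<And>z. z \<in> \<Omega> \<Longrightarrow> (f w - L f z) * k z = 1"
        using resolvent[OF lin_in[OF lin f], of "f w"] by auto
      obtain h where h: "h \<in> A" "L h = k" using surj[OF k(1)] by blast
      have "L (\<lambda>z. (cst (f w) z - f z) * h z) = cst 1"
      proof (rule A_eqI)
        show "L (\<lambda>z. (cst (f w) z - f z) * h z) z = cst 1 z" if z: "z \<in> \<Omega>" for z
          unfolding prod[OF f h(1) z] h(2) cst_apply[OF z] by (rule k(2)[OF z])
      qed (intro lin_in[OF lin] A_mult A_diff A_cst f h)+
      hence "L (\<lambda>z. (cst (f w) z - f z) * h z) = L (cst 1)" by (simp only: one)
      hence "(\<lambda>z. (cst (f w) z - f z) * h z) = cst 1"
        by (rule inj[OF A_mult[OF A_diff[OF A_cst f] h(1)] A_cst])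
      from fun_cong[OF this, of w] show False using w by simp
    qed
  qed
  moreover have "L ` A = A" using bij by (simp add: bij_betw_def)
  ultimately show "L \<in> {L \<in> Iso A N. L (cst 1) = cst 1}" using lin one by (simp add: Iso_def)
qed

lemma ref_to_Aut_eq:
  assumes "simply_connected \<Omega>"
  shows "ref_to A N (Aut A N) = Aut A N"
proof
  show "Aut A N \<subseteq> ref_to A N (Aut A N)" by (rule subset_ref_to) (auto simp: Aut_def)
  show "ref_to A N (Aut A N) \<subseteq> Aut A N"
  proof
    fix T assume T: "T \<in> ref_to A N (Aut A N)"
    have "Aut A N \<subseteq> Iso A N" unfolding Aut_eq by blast
    hence Iso: "T \<in> Iso A N" using T ref_to_mono ref_to_Iso_eq[OF assms] by blast
    have "T (cst 1) z = 1" if z: "z \<in> \<Omega>" for z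
    proof -
      have "norm (T (cst 1) z - 1) \<le> 0"
      proof (rule field_le_epsilon)
        fix e :: real assume "0 < e"
        then obtain L where "L \<in> Aut A N" "norm (T (cst 1) z - L (cst 1) z) < e"
          using ref_to_approx[OF T A_cst] z by metis
        thus "norm (T (cst 1) z - 1) \<le> 0 + e" using z by (simp add: Aut_eq)
      qed
      thus ?thesis by simp
    qed
    hence "T (cst 1) = cst 1" by (intro A_eqI A_cst lin_in[OF Iso_lin[OF Iso]]) auto
    thus "T \<in> Aut A N" using Iso by (simp add: Aut_eq)
  qed
qed

end

theorem theorem7:
  fixes \<Omega> :: "complex set"
  assumes "open \<Omega>" and "connected \<Omega>" and "\<Omega> \<noteq> {}" and "simply_connected \<Omega>"
  shows "topologically_reflexive (H_infinity \<Omega>) (sup_norm \<Omega>)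
           (Iso (H_infinity \<Omega>) (sup_norm \<Omega>)) \<and>
         topologically_reflexive (H_infinity \<Omega>) (sup_norm \<Omega>)
           (Aut (H_infinity \<Omega>) (sup_norm \<Omega>))"
proof -
  interpret planar_domain \<Omega> using assms by unfold_locales
  show ?thesis
    unfolding topologically_reflexive_def using ref_to_Iso_eq ref_to_Aut_eq assms(4) by blast
qed

end
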